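(* Let $n,m,p\ge1$ be integers with $\tau(p)>m$, let $b\in\mathbb R^m$ and $R_Y\in\mathbb R_+$ be fixed, and let $\boldsymbol\varepsilon=(\varepsilon_0,\varepsilon_1,\varepsilon_2)\in\mathbb R_+^3$ with $\varepsilon_0,\varepsilon_2>0$. Let $\bar{\mathcal A}\in(\mathbb S^n)^m$, $\sigma>0$, and let $\mathcal A$ be uniformly distributed on the Euclidean ball in $(\mathbb S^n)^m$ of radius $\sigma$ centered at $\bar{\mathcal A}$. Set $$R_A:=\|\bar{\mathcal A}\|+\sigma,\qquad\delta:=\frac{\varepsilon_1R_A}{\sqrt{\varepsilon_2}},\qquad\kappa:=2(R_AR_Y^2+\|b\|)R_A .$$ If $\delta<\dfrac{\sigma\varepsilon_0}{4n^3m}$, then $$\Pr[\,\mathcal A\in\mathscr A_{\boldsymbol\varepsilon}\,]\;\le\;4e\,\delta^{\tau(p)-m}\,(3\kappa)^m\,\Big(\frac{2n^3m}{\sigma\varepsilon_0}\Big)^{\tau(p)},$$ where $\mathscr A_{\boldsymbol\varepsilon}\subset(\mathbb S^n)^m$ is the set of all $\mathcal A$ for which there exists a spurious $\boldsymbol\varepsilon$-AC point.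
   Context: $\mathbb S^n$ is the space of real symmetric $n\times n$ matrices, $A\bullet B=\operatorname{tr}(A^TB)$, all matrix norms are Frobenius norms, $\tau(k)=\binom{k+1}{2}$. A tuple $\mathcal A=(A_1,\dots,A_m)\in(\mathbb S^n)^m$ is identified with the linear map $\mathcal A(X)=(A_1\bullet X,\dots,A_m\bullet X)$ (also applied to nonsymmetric $X$); $\|\bar{\mathcal A}\|$ is the operator norm of the corresponding map; $\mathcal A^*(\lambda)=\sum_i\lambda_iA_i$; $S(X)=2\mathcal A^*(\mathcal A(X)-b)$. (LS): $\min_{X\in\mathbb S^n}\|\mathcal A(X)-b\|^2$ s.t. $X\succeq0$. (BM-LS): $\min_{Y\in\mathbb R^{n\times p}}\|\mathcal A(YY^T)-b\|^2$. $X\in\mathbb S^n$ is $(\varepsilon_0,\varepsilon_1,\varepsilon_2)$-approximately optimal for (LS) if $X\succeq0$ and either $\|\mathcal A(X)-b\|\le\varepsilon_0$, or both $\|S(X)X\|\le\varepsilon_1$ and $S(X)\succeq-\varepsilon_2I_n$. $Y\in\mathbb R^{n\times p}$ is $(\varepsilon_1,\varepsilon_2)$-AC (approximately 2-critical) for (BM-LS) if $\|S(YY^T)Y\|\le\varepsilon_1$ and $S(YY^T)\bullet UU^T+4\|\mathcal A(UY^T)\|^2\ge-\varepsilon_2$ for all $U\in\mathbb R^{n\times p}$ with $\|U\|=1$. $Y$ is a spurious $\boldsymbol\varepsilon$-AC point if $Y$ is $(\varepsilon_1,\varepsilon_2)$-AC for (BM-LS), $YY^T$ is not $(\varepsilon_0,R_Y\varepsilon_1,5\varepsilon_2)$-approximately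 optimal for (LS), and $\|Y\|\le R_Y$. *)

theory Defs
  imports "HOL-Probability.Probability"
begin

text \<open>
  An \<open>n \<times> p\<close> matrix is an element of \<open>real^'p^'n\<close>. The library's inner product on this type is
  the trace inner product (lemma \<open>inner_eq_trace\<close>), so \<open>norm\<close> is the Frobenius norm. A tuple
  \<open>(A\<^sub>1, \<dots>, A\<^sub>m)\<close> is an element of \<open>(real^'n^'n)^'m\<close>, whose library norm is the Euclidean one.
\<close>

lemma inner_eq_trace:
  fixes A B :: "real^'p^'n"
  shows "A \<bullet> B = trace (transpose A ** B)"
proof -
  have "trace (transpose A ** B) = (\<Sum>j\<in>UNIV. \<Sum>i\<in>UNIV. A $ i $ j * B $ i $ j)"
    by (simp add: trace_def matrix_matrix_mult_def transpose_def)
  also have "\<dots> = A \<bullet> B"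
    by (subst sum.swap) (simp add: inner_vec_def)
  finally show ?thesis ..
qed

definition sym_mats :: "(real^'n^'n) set" where
  "sym_mats = {X. transpose X = X}"

definition sym_tuples :: "((real^'n^'n)^'m) set" where
  "sym_tuples = {A. \<forall>k. A $ k \<in> sym_mats}"

definition psd :: "real^'n^'n \<Rightarrow> bool" where
  "psd X \<longleftrightarrow> X \<in> sym_mats \<and> (\<forall>v. 0 \<le> v \<bullet> (X *v v))"

definition loewner_le :: "real^'n^'n \<Rightarrow> real^'n^'n \<Rightarrow> bool" where
  "loewner_le X Z \<longleftrightarrow> psd (Z - X)"

definition meas_map :: "(real^'n^'n)^'m \<Rightarrow> real^'n^'n \<Rightarrow> real^'m" where
  "meas_map A X = (\<chi> i. A $ i \<bullet> X)"

definition meas_adj :: "(real^'n^'n)^'m \<Rightarrow> real^'m \<Rightarrow> real^'n^'n" where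
  "meas_adj A l = (\<Sum>i\<in>UNIV. l $ i *\<^sub>R A $ i)"

definition slack :: "(real^'n^'n)^'m \<Rightarrow> real^'m \<Rightarrow> real^'n^'n \<Rightarrow> real^'n^'n" where
  "slack A b X = 2 *\<^sub>R meas_adj A (meas_map A X - b)"

definition approx_optimal ::
  "(real^'n^'n)^'m \<Rightarrow> real^'m \<Rightarrow> real \<Rightarrow> real \<Rightarrow> real \<Rightarrow> real^'n^'n \<Rightarrow> bool" where
  "approx_optimal A b e0 e1 e2 X \<longleftrightarrow>
     psd X \<and>
     (norm (meas_map A X - b) \<le> e0 \<or>
      norm (slack A b X ** X) \<le> e1 \<and> loewner_le (- e2 *\<^sub>R mat 1) (slack A b X))"

definition approx_2_critical ::
  "(real^'n^'n)^'m \<Rightarrow> real^'m \<Rightarrow> real \<Rightarrow> real \<Rightarrow> real^'p^'n \<Rightarrow> bool" where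
  "approx_2_critical A b e1 e2 Y \<longleftrightarrow>
     norm (slack A b (Y ** transpose Y) ** Y) \<le> e1 \<and>
     (\<forall>U :: real^'p^'n. norm U = 1 \<longrightarrow>
        slack A b (Y ** transpose Y) \<bullet> (U ** transpose U)
          + 4 * (norm (meas_map A (U ** transpose Y)))\<^sup>2 \<ge> - e2)"

definition spurious_AC ::
  "(real^'n^'n)^'m \<Rightarrow> real^'m \<Rightarrow> real \<Rightarrow> real \<Rightarrow> real \<Rightarrow> real \<Rightarrow> real^'p^'n \<Rightarrow> bool" where
  "spurious_AC A b R e0 e1 e2 Y \<longleftrightarrow>
     approx_2_critical A b e1 e2 Y \<and>
     \<not> approx_optimal A b e0 (R * e1) (5 * e2) (Y ** transpose Y) \<and>
     norm Y \<le> R"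

text \<open>The extra argument \<open>TYPE('p)\<close> fixes the number of columns of \<open>Y\<close>.\<close>

definition bad_tuples ::
  "'p::finite itself \<Rightarrow> real^'m \<Rightarrow> real \<Rightarrow> real \<Rightarrow> real \<Rightarrow> real \<Rightarrow> ((real^'n^'n)^'m) set" where
  "bad_tuples _ b R e0 e1 e2 =
     {A \<in> sym_tuples. \<exists>Y :: real^'p^'n. spurious_AC A b R e0 e1 e2 Y}"

definition tau :: "nat \<Rightarrow> nat" where
  "tau k = (k + 1) choose 2"

text \<open>
  Tuples of symmetric matrices form a proper linear subspace of the type \<open>(real^'n^'n)^'m\<close>, so
  they are null for \<open>lborel\<close>. Lebesgue measure on that subspace is obtained, as \<open>lborel\<close> itself
  is, as the image of a product of one-dimensional Lebesgue measures under an orthonormal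
  coordinate system: the matrices \<open>E\<^sub>i\<^sub>i\<close> and \<open>(E\<^sub>i\<^sub>j + E\<^sub>j\<^sub>i) / sqrt 2\<close> in each of the \<open>m\<close> slots.
  Since a basis is a set, the pairs \<open>(i, j)\<close> and \<open>(j, i)\<close> contribute only one element.
\<close>

definition sym_unit :: "'n \<Rightarrow> 'n \<Rightarrow> real^'n^'n" where
  "sym_unit i j = axis i (axis j 1) + axis j (axis i 1)"

definition sym_tuples_basis :: "((real^'n^'n)^'m) set" where
  "sym_tuples_basis = {axis k (sgn (sym_unit i j)) | k i j. True}"

definition lborel_sym_tuples :: "((real^'n^'n)^'m) measure" where
  "lborel_sym_tuples =
     distr (\<Pi>\<^sub>M B\<in>sym_tuples_basis. lborel) borel (\<lambda>f. \<Sum>B\<in>sym_tuples_basis. f B *\<^sub>R B)"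

lemma inner_axis_axis_1:
  "axis a (axis c (1::real)) \<bullet> axis a' (axis c' 1) = of_bool (a = a') * of_bool (c = c')"
  by (cases "a = a'"; cases "c = c'") (simp_all add: inner_axis_axis)

lemma inner_sym_unit:
  "sym_unit i j \<bullet> sym_unit k l =
     2 * (of_bool (i = k) * of_bool (j = l) + of_bool (i = l) * of_bool (j = k))"
proof -
  have *: "(a * b + d * c) + (c * d + b * a) = 2 * (a * b + c * d)" for a b c d :: real
    by (simp only: mult_2 mult.commute add.commute)
  show ?thesis
    unfolding sym_unit_def inner_add_left inner_add_right inner_axis_axis_1 by (rule *)
qed

lemma sym_unit_nonzero: "sym_unit i j \<noteq> 0"
proof
  assume "sym_unit i j = 0"
  then have "sym_unit i j \<bullet> sym_unit i j = 0"
    by (simp only: inner_zero_left)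
  moreover have "2 * (1 * 1 + of_bool p * of_bool q) \<noteq> (0::real)" for p q
    by (cases p; cases q) simp_all
  ultimately show False
    unfolding inner_sym_unit by (simp only: simp_thms of_bool_eq)
qed

lemma sym_unit_commute: "sym_unit i j = sym_unit j i"
  unfolding sym_unit_def by (rule add.commute)

lemma sym_unit_nth:
  "sym_unit i j $ a $ c = of_bool (i = a) * of_bool (j = c) + of_bool (i = c) * of_bool (j = a)"
proof -
  have "axis k (axis l (1::real)) $ a $ c = of_bool (k = a) * of_bool (l = c)" for k l
    by (cases "k = a"; cases "l = c") (simp_all add: axis_def)
  then show ?thesis
    unfolding sym_unit_def vector_add_component by (simp only: mult.commute)
qed

lemma finite_sym_tuples_basis: "finite (sym_tuples_basis :: ((real^'n^'n)^'m) set)"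
proof -
  have "sym_tuples_basis \<subseteq>
      (\<lambda>(k, i, j). axis k (sgn (sym_unit i j)) :: (real^'n^'n)^'m) ` UNIV"
    unfolding sym_tuples_basis_def image_def by (auto simp: Bex_def)
  then show ?thesis
    by (rule finite_subset) simp
qed

lemma norm_sym_tuples_basis:
  assumes "B \<in> sym_tuples_basis"
  shows "norm B = 1"
proof -
  obtain k i j where B: "B = axis k (sgn (sym_unit i j))"
    using assms unfolding sym_tuples_basis_def by blast
  have unit: "norm (sgn (sym_unit i j)) = 1"
    by (simp only: norm_sgn sym_unit_nonzero if_False)
  have "B \<bullet> B = sgn (sym_unit i j) \<bullet> sgn (sym_unit i j)"
    by (simp only: B inner_axis_axis if_True simp_thms)
  also have "\<dots> = 1"
    using unit by (simp only: norm_eq_1)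
  finally show ?thesis
    by (simp only: norm_eq_1)
qed

lemma orthogonal_sym_tuples_basis:
  "pairwise orthogonal (sym_tuples_basis :: ((real^'n^'n)^'m) set)"
proof (rule pairwiseI)
  fix B C :: "(real^'n^'n)^'m"
  assume B': "B \<in> sym_tuples_basis" and C': "C \<in> sym_tuples_basis" and neq: "B \<noteq> C"
  obtain k i j where B: "B = axis k (sgn (sym_unit i j))"
    using B' unfolding sym_tuples_basis_def by blast
  obtain k' i' j' where C: "C = axis k' (sgn (sym_unit i' j'))"
    using C' unfolding sym_tuples_basis_def by blast
  show "orthogonal B C"
  proof (cases "k = k'")
    case True
    then have "sym_unit i j \<noteq> sym_unit i' j'"
      using neq unfolding B C by auto
    then have neq': "\<not> (i = i' \<and> j = j')" "\<not> (i = j' \<and> j = i')"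
      using sym_unit_commute[of i j] by auto
    have *: "of_bool P * of_bool Q = (0 :: real)" if "\<not> (P \<and> Q)" for P Q
      using that by (cases P; cases Q) simp_all
    have "sym_unit i j \<bullet> sym_unit i' j' = 0"
      unfolding inner_sym_unit *[OF neq'(1)] *[OF neq'(2)] by (simp only: add_0_left mult_zero_right)
    then show ?thesis
      unfolding orthogonal_def B C inner_axis_axis sgn_div_norm by simp
  next
    case False
    then show ?thesis
      unfolding orthogonal_def B C inner_axis_axis by simp
  qed
qed

lemma span_sym_tuples_basis:
  "span sym_tuples_basis = (sym_tuples :: ((real^'n^'n)^'m) set)"
proof
  have "subspace (sym_tuples :: ((real^'n^'n)^'m) set)"
    by (auto simp: subspace_def sym_tuples_def sym_mats_def transpose_def vec_eq_iff)
  moreover have "sym_tuples_basis \<subseteq> (sym_tuples :: ((real^'n^'n)^'m) set)"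
  proof -
    have "sym_unit i j $ c $ a = sym_unit i j $ a $ c" for i j a c :: 'n
      by (simp only: sym_unit_nth add.commute)
    then have unit: "sgn (sym_unit i j) \<in> sym_mats" for i j :: 'n
      by (simp add: sym_mats_def transpose_def vec_eq_iff sgn_div_norm)
    moreover have "(0 :: real^'n^'n) \<in> sym_mats"
      by (simp add: sym_mats_def transpose_def vec_eq_iff)
    ultimately have "axis k (sgn (sym_unit i j)) \<in> (sym_tuples :: ((real^'n^'n)^'m) set)"
      for k and i j :: 'n
      by (simp add: sym_tuples_def axis_def)
    then show ?thesis
      by (auto simp: sym_tuples_basis_def)
  qed
  ultimately show "span sym_tuples_basis \<subseteq> (sym_tuples :: ((real^'n^'n)^'m) set)"
    by (simp add: span_minimal)
next
  show "(sym_tuples :: ((real^'n^'n)^'m) set) \<subseteq> span sym_tuples_basis"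
  proof
    fix A :: "(real^'n^'n)^'m"
    assume "A \<in> sym_tuples"
    then have sym: "A $ k $ j $ i = A $ k $ i $ j" for k i j
      by (auto simp: sym_tuples_def sym_mats_def transpose_def vec_eq_iff)
    have unit: "axis k (sym_unit i j) \<in> span (sym_tuples_basis :: ((real^'n^'n)^'m) set)"
      for k and i j :: 'n
    proof -
      have "axis k (sym_unit i j) =
          norm (sym_unit i j) *\<^sub>R (axis k (sgn (sym_unit i j)) :: (real^'n^'n)^'m)"
        using sym_unit_nonzero[of i j]
        by (subst vec_eq_iff) (simp add: axis_def sgn_div_norm)
      moreover have "axis k (sgn (sym_unit i j)) \<in> (sym_tuples_basis :: ((real^'n^'n)^'m) set)"
        by (auto simp: sym_tuples_basis_def)
      ultimately show ?thesis
        by (metis span_base span_scale)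
    qed
    have pick: "(\<Sum>i\<in>UNIV. \<Sum>j\<in>UNIV. f i j * (of_bool (i = a) * of_bool (j = c))) = f a c"
      for f :: "'n \<Rightarrow> 'n \<Rightarrow> real" and a c
    proof -
      have "(\<Sum>j\<in>UNIV. f i j * (of_bool (i = a) * of_bool (j = c))) = (if i = a then f i c else 0)"
        for i
        by (cases "i = a") (simp_all add: of_bool_def if_distrib cong: if_cong)
      then show ?thesis by simp
    qed
    have "A = (\<Sum>k\<in>UNIV. \<Sum>i\<in>UNIV. \<Sum>j\<in>UNIV. (A $ k $ i $ j / 2) *\<^sub>R axis k (sym_unit i j))"
      (is "A = ?S")
    proof -
      have "?S $ k $ a $ c = A $ k $ a $ c" for k a c
      proof -
        have "?S $ k $ a $ c =
            (\<Sum>k'\<in>UNIV. \<Sum>i\<in>UNIV. \<Sum>j\<in>UNIV.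
               (A $ k' $ i $ j / 2) * ((axis k' (sym_unit i j) :: (real^'n^'n)^'m) $ k $ a $ c))"
          by simp
        also have "\<dots> = (\<Sum>k'\<in>UNIV. if k' = k then
            (\<Sum>i\<in>UNIV. \<Sum>j\<in>UNIV. (A $ k $ i $ j / 2) * (sym_unit i j $ a $ c)) else 0)"
          by (intro sum.cong refl) (auto simp: axis_def)
        also have "\<dots> = (\<Sum>i\<in>UNIV. \<Sum>j\<in>UNIV. (A $ k $ i $ j / 2) * (sym_unit i j $ a $ c))"
          by simp
        also have "\<dots> = (\<Sum>i\<in>UNIV. \<Sum>j\<in>UNIV.
            (A $ k $ i $ j / 2) * (of_bool (i = a) * of_bool (j = c))) +
            (\<Sum>i\<in>UNIV. \<Sum>j\<in>UNIV. (A $ k $ i $ j / 2) * (of_bool (i = c) * of_bool (j = a)))"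
          by (simp only: sym_unit_nth distrib_left sum.distrib)
        also have "\<dots> = A $ k $ a $ c"
          unfolding pick by (simp add: sym)
        finally show ?thesis .
      qed
      then show ?thesis by (simp add: vec_eq_iff)
    qed
    also have "\<dots> \<in> span sym_tuples_basis"
      by (intro span_sum span_scale unit)
    finally show "A \<in> span sym_tuples_basis" .
  qed
qed

end

(*
  Let Y be spurious, S = S(Y Y^T) = A^*(l). Testing second-order criticality with rank-one U shows
  |Y x| >= (sqrt e2 / R_A) |x|. Choose p rows f of Y with maximal |determinant|, and let
  W = Y Y_f^{-1}. Then W restricted to the rows f is the identity, the entries of W are bounded by 1
  (Cramer), hence |W|^2 <= p (n - p + 1), and |S W| <= delta |W|.

  For fixed l and f, two tuples of this kind that differ only in the direction
  (l / |l|) (x) (symmetric p x p block on the rows f) are at distance O(delta p (n - p + 1) / |l|):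
  the block difference is W'^T (S' - S) W. These directions form a space of dimension tau(p), so a
  set all of whose slices in these directions are that small has small volume: it has many disjoint
  translates inside a slightly larger ball. A union bound over a net of multipliers l with mesh
  delta / R_A and over f finishes the proof; no volume estimate for tubes around varieties is needed.
*)
theory Submission
  imports Defs
begin

subsection \<open>Lebesgue measure on the span of an orthonormal set\<close>

text \<open>The exponent is a dimension count. Multipliers live in m dimensions, so the net over
  them costs about (3 \<kappa> / \<delta>)^m sets, and each of these sets gains \<delta>^tau(p).
  Discretising Y itself would cost np dimensions. Hence Y enters only through l and W, and W is
  never discretised: W and W' of two tuples in a slice may differ freely, because only their common
  identity rows are compared. A merely invertible Y_f would leave |W|, and with it the slice
  diameter, uncontrolled; this is why the determinant is maximised. Constants: the tolerance is 2
  \<delta>, one \<delta> from Y and one from rounding l. With |l| >= 2 e0 on the net, slices have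
  diameter at most 2 \<delta> p (n - p + 1) / e0. The translations have length at most \<sigma> /
  (nm), so the base of the power tau(p) is \<delta> (p (n - p + 1) / n^2) (2 n^3 m / (\<sigma> e0)).
  One factor 2 sqrt e of 4e is the price of the translates; the other bounds the at most n^p choices
  of f times the tau(p)-th power of p (n - p + 1) / n^2.\<close>

definition orthonormal :: "'a::euclidean_space set \<Rightarrow> bool" where
  "orthonormal B \<longleftrightarrow> finite B \<and> pairwise orthogonal B \<and> (\<forall>b\<in>B. norm b = 1)"

lemma orthonormalD:
  assumes "orthonormal B"
  shows "finite B" "pairwise orthogonal B" "b \<in> B \<Longrightarrow> norm b = 1"
  using assms by (auto simp: orthonormal_def)

text \<open>The set \<open>B\<close> is left general because two subspaces need a volume: the
  symmetric tuples themselves, and the block directions inside them, where volume is used to count a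
  packing.\<close>

definition span_lborel :: "'a::euclidean_space set \<Rightarrow> 'a measure" where
  "span_lborel B = distr (\<Pi>\<^sub>M b\<in>B. lborel) borel (\<lambda>f. \<Sum>b\<in>B. f b *\<^sub>R b)"

lemma sets_span_lborel [simp, measurable_cong]: "sets (span_lborel B) = sets borel"
  and space_span_lborel [simp]: "space (span_lborel B) = UNIV"
  by (simp_all add: span_lborel_def)

lemma measurable_span_lborel_coords [measurable]:
  fixes B :: "'a::euclidean_space set"
  shows "(\<lambda>f. \<Sum>b\<in>B. f b *\<^sub>R b) \<in> borel_measurable (\<Pi>\<^sub>M b\<in>B. (lborel :: real measure))"
proof (intro borel_measurable_sum borel_measurable_scaleR borel_measurable_const)
  fix b assume "b \<in> B"
  from measurable_component_singleton[OF this, of "\<lambda>_. lborel :: real measure"]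
  show "(\<lambda>f. f b) \<in> borel_measurable (\<Pi>\<^sub>M b\<in>B. (lborel :: real measure))"
    by simp
qed

lemma emeasure_span_lborel:
  assumes "X \<in> sets borel"
  shows "emeasure (span_lborel B) X =
    emeasure (\<Pi>\<^sub>M b\<in>B. lborel) ({f. (\<Sum>b\<in>B. f b *\<^sub>R b) \<in> X} \<inter> space (\<Pi>\<^sub>M b\<in>B. lborel))"
  using assms unfolding span_lborel_def by (subst emeasure_distr) (auto simp: vimage_def)

text \<open>A product measure is determined by its values on boxes, and the map acts on a box
  coordinate by coordinate, so the one-dimensional affine formula is applied \<open>card I\<close>
  times.\<close>

lemma PiM_lborel_affine:
  fixes t :: "'i \<Rightarrow> real"
  assumes I: "finite I" and c: "c > 0"
  shows "(\<Pi>\<^sub>M i\<in>I. lborel) =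
    scale_measure (ennreal (c ^ card I))
      (distr (\<Pi>\<^sub>M i\<in>I. lborel) (\<Pi>\<^sub>M i\<in>I. lborel) (\<lambda>f. \<lambda>i\<in>I. t i + c * f i))"
    (is "?P = scale_measure _ ?D")
proof -
  interpret product_sigma_finite "\<lambda>_::'i. lborel :: real measure"
    by standard
  have meas [measurable]: "(\<lambda>f. \<lambda>i\<in>I. t i + c * f i) \<in> measurable ?P ?P"
    by measurable
  have "scale_measure (ennreal (c ^ card I)) ?D = ?P"
  proof (rule PiM_eqI[OF I])
    fix X :: "'i \<Rightarrow> real set"
    assume X: "\<And>i. i \<in> I \<Longrightarrow> X i \<in> sets lborel"
    define X' where "X' i = (\<lambda>x. t i + c * x) -` X i" for i
    have X': "X' i \<in> sets lborel" if "i \<in> I" for i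
      using measurable_sets_borel[of "\<lambda>x. t i + c * x" borel "X i"] X[OF that] unfolding X'_def
      by simp
    have PX: "Pi\<^sub>E I X \<in> sets ?P"
      using X I by (intro sets_PiM_I_finite) auto
    have eq: "(\<lambda>f. \<lambda>i\<in>I. t i + c * f i) -` Pi\<^sub>E I X \<inter> space ?P = Pi\<^sub>E I X'"
      by (auto simp: X'_def space_PiM PiE_def Pi_def)
    have one: "ennreal c * emeasure lborel (X' i) = emeasure lborel (X i)" if "i \<in> I" for i
    proof -
      have "emeasure lborel (X i) = emeasure (density (distr lborel borel (\<lambda>x. t i + c * x)) (\<lambda>_. ennreal c)) (X i)"
        using lborel_real_affine[of c "t i"] c by simp
      also have "\<dots> = ennreal c * emeasure lborel (X' i)"
        using X[OF that] by (simp add: emeasure_density nn_integral_cmult_indicator emeasure_distr X'_def)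
      finally show ?thesis by simp
    qed
    have "emeasure ?D (Pi\<^sub>E I X) = (\<Prod>i\<in>I. emeasure lborel (X' i))"
      using PX eq X' I by (simp add: emeasure_distr emeasure_PiM)
    then have "emeasure (scale_measure (ennreal (c ^ card I)) ?D) (Pi\<^sub>E I X)
       = (\<Prod>i\<in>I. ennreal c * emeasure lborel (X' i))"
      using c by (simp add: prod.distrib ennreal_power)
    also have "\<dots> = (\<Prod>i\<in>I. emeasure lborel (X i))"
      using one by (intro prod.cong) auto
    finally show "emeasure (scale_measure (ennreal (c ^ card I)) ?D) (Pi\<^sub>E I X) = (\<Prod>i\<in>I. emeasure lborel (X i))" .
  qed simp
  then show ?thesis ..
qed

lemma span_finite_sum:
  assumes "finite B" "t \<in> span B"
  obtains g :: "'a::euclidean_space \<Rightarrow> real" where "t = (\<Sum>b\<in>B. g b *\<^sub>R b)"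
  using assms span_finite by auto

text \<open>With \<open>c = 1\<close> this is invariance under translations along the subspace, with
  \<open>t = 0\<close> it is the scaling law. The exponent is the size of \<open>B\<close>, not the
  dimension of the ambient space.\<close>

lemma emeasure_span_lborel_affine:
  fixes B :: "'a::euclidean_space set"
  assumes B: "finite B" and t: "t \<in> span B" and c: "c > 0" and X: "X \<in> sets borel"
  shows "emeasure (span_lborel B) X = ennreal (c ^ card B) * emeasure (span_lborel B) {x. t + c *\<^sub>R x \<in> X}"
proof -
  obtain g where g: "t = (\<Sum>b\<in>B. g b *\<^sub>R b)"
    using span_finite_sum[OF B t] .
  let ?P = "\<Pi>\<^sub>M b\<in>B. (lborel :: real measure)"
  let ?T = "\<lambda>f. \<Sum>b\<in>B. f b *\<^sub>R b"
  let ?h = "\<lambda>f. \<lambda>b\<in>B. g b + c * f b"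
  have meas: "?h \<in> measurable ?P ?P" by measurable
  have X2: "{x. t + c *\<^sub>R x \<in> X} \<in> sets borel"
    using measurable_sets_borel[of "\<lambda>x. t + c *\<^sub>R x" borel X] X by (simp add: vimage_def)
  have Y: "{f. ?T f \<in> X} \<inter> space ?P \<in> sets ?P"
    using measurable_sets[OF measurable_span_lborel_coords[of B] X] by (simp add: vimage_def)
  have T: "(\<Sum>b\<in>B. (g b + c * f b) *\<^sub>R b) = t + c *\<^sub>R ?T f" for f
    by (simp add: g scaleR_add_left sum.distrib scaleR_sum_right)
  have "emeasure (span_lborel B) X = emeasure ?P ({f. ?T f \<in> X} \<inter> space ?P)"
    by (rule emeasure_span_lborel[OF X])
  also have "\<dots> = ennreal (c ^ card B) * emeasure (distr ?P ?P ?h) ({f. ?T f \<in> X} \<inter> space ?P)"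
    by (subst PiM_lborel_affine[OF B c, of g]) simp
  also have "emeasure (distr ?P ?P ?h) ({f. ?T f \<in> X} \<inter> space ?P)
      = emeasure ?P ({f. t + c *\<^sub>R ?T f \<in> X} \<inter> space ?P)"
    using meas Y by (subst emeasure_distr) (auto intro!: arg_cong[where f="emeasure ?P"] simp: T space_PiM)
  also have "\<dots> = emeasure (span_lborel B) {x. t + c *\<^sub>R x \<in> X}"
    using emeasure_span_lborel[OF X2, of B] by simp
  finally show ?thesis .
qed

lemma emeasure_span_lborel_Int_span:
  assumes "X \<in> sets borel"
  shows "emeasure (span_lborel B) (X \<inter> span B) = emeasure (span_lborel B) X"
proof -
  have "(\<Sum>b\<in>B. f b *\<^sub>R b) \<in> span B" for f :: "'a \<Rightarrow> real"
    by (intro span_sum span_scale span_base)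
  moreover have "X \<inter> span B \<in> sets borel"
    using assms by (simp add: closed_subspace borel_closed)
  ultimately show ?thesis
    using assms by (simp add: emeasure_span_lborel)
qed

lemma inner_sum_orthonormal:
  fixes B :: "'a::euclidean_space set"
  assumes "orthonormal B" "b \<in> B"
  shows "(\<Sum>x\<in>B. f x *\<^sub>R x) \<bullet> b = f b"
proof -
  have "(\<Sum>x\<in>B. f x *\<^sub>R x) \<bullet> b = (\<Sum>x\<in>B. if x = b then f b else 0)"
    unfolding inner_sum_left
  proof (intro sum.cong refl)
    fix x assume "x \<in> B"
    then show "(f x *\<^sub>R x) \<bullet> b = (if x = b then f b else 0)"
      using assms by (auto simp: orthonormal_def pairwise_def orthogonal_def norm_eq_1)
  qed
  then show ?thesis using assms by (simp add: orthonormalD(1))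
qed

text \<open>Only ratios of ball volumes matter later, so no exact volume is computed. Finiteness
  comes from a coordinate cube around the ball, positivity from a cube inside it, and the ratios
  from the affine law.\<close>

lemma measure_cball_span_lborel:
  fixes B :: "'a::euclidean_space set"
  assumes orth: "orthonormal B" and c: "c \<in> span B"
  shows "emeasure (span_lborel B) (cball c r) < \<infinity>"
    and "r > 0 \<Longrightarrow> emeasure (span_lborel B) (cball c r) > 0"
    and "\<lbrakk>r > 0; s > 0\<rbrakk> \<Longrightarrow> measure (span_lborel B) (cball c r)
       = (r / s) ^ card B * measure (span_lborel B) (cball c s)"
    and "measure (span_lborel B) (cball c r) = measure (span_lborel B) (cball 0 r)"
proof -
  let ?P = "\<Pi>\<^sub>M b\<in>B. (lborel :: real measure)"
  interpret product_sigma_finite "\<lambda>_::'a. lborel :: real measure"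
    by standard
  note B = orthonormalD[OF orth]
  have tr: "emeasure (span_lborel B) (cball c r) = emeasure (span_lborel B) (cball 0 r)" for r
  proof -
    have "{x. c + 1 *\<^sub>R x \<in> cball c r} = cball 0 r"
      by (auto simp: dist_norm)
    then show ?thesis
      using emeasure_span_lborel_affine[OF B(1) c, of 1 "cball c r"] by simp
  qed
  have fin0: "emeasure (span_lborel B) (cball 0 r) < \<infinity>" for r
  proof -
    have sub: "{f. (\<Sum>b\<in>B. f b *\<^sub>R b) \<in> cball 0 r} \<inter> space ?P \<subseteq> Pi\<^sub>E B (\<lambda>_. {-r..r})"
    proof
      fix f assume f: "f \<in> {f. (\<Sum>b\<in>B. f b *\<^sub>R b) \<in> cball 0 r} \<inter> space ?P"
      have "\<bar>f b\<bar> \<le> r" if "b \<in> B" for b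
      proof -
        have "\<bar>f b\<bar> = \<bar>(\<Sum>x\<in>B. f x *\<^sub>R x) \<bullet> b\<bar>"
          using inner_sum_orthonormal[OF orth that] by simp
        also have "\<dots> \<le> norm (\<Sum>x\<in>B. f x *\<^sub>R x) * norm b"
          by (rule Cauchy_Schwarz_ineq2)
        also have "\<dots> \<le> r" using f B(3)[OF that] by simp
        finally show ?thesis .
      qed
      then have "f b \<in> {-r..r}" if "b \<in> B" for b
        using that by (force simp: abs_le_iff)
      moreover have "f \<in> extensional B"
        using f by (simp add: space_PiM PiE_def)
      ultimately show "f \<in> Pi\<^sub>E B (\<lambda>_. {-r..r})"
        by (simp add: PiE_iff)
    qed
    have "emeasure (span_lborel B) (cball 0 r) \<le> emeasure ?P (Pi\<^sub>E B (\<lambda>_. {-r..r}))"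
      unfolding emeasure_span_lborel[OF borel_closed[OF closed_cball]]
      using sub B(1) by (intro emeasure_mono sets_PiM_I_finite) auto
    also have "\<dots> = (\<Prod>b\<in>B. emeasure lborel {-r..r})"
      using B(1) by (intro emeasure_PiM) auto
    also have "\<dots> < \<infinity>"
    proof -
      have "emeasure lborel {-r..r} < \<infinity>" by (simp add: emeasure_lborel_Icc_eq)
      then show ?thesis by (simp add: power_eq_top_ennreal flip: less_top)
    qed
    finally show ?thesis .
  qed
  have pos0: "emeasure (span_lborel B) (cball 0 r) > 0" if r: "r > 0" for r
  proof -
    \<comment> \<open>The triangle inequality over \<open>card B\<close> terms needs
      \<open>card B * q\<close> to be at most \<open>r\<close>; the added 1 keeps the divisor
      nonzero when \<open>B\<close> is empty.\<close>
    define q where "q = r / (real (card B) + 1)"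
    have q: "q > 0" using r by (simp add: q_def)
    have sub: "Pi\<^sub>E B (\<lambda>_. {-q..q}) \<subseteq> {f. (\<Sum>b\<in>B. f b *\<^sub>R b) \<in> cball 0 r} \<inter> space ?P"
    proof
      fix f assume f: "f \<in> Pi\<^sub>E B (\<lambda>_. {-q..q})"
      have "norm (\<Sum>b\<in>B. f b *\<^sub>R b) \<le> (\<Sum>b\<in>B. q)"
      proof (rule sum_norm_le)
        fix b assume "b \<in> B"
        then have "f b \<in> {-q..q}" "norm b = 1" using f B(3) by auto
        then show "norm (f b *\<^sub>R b) \<le> q" by auto
      qed
      also have "\<dots> = card B * q" by simp
      also have "\<dots> \<le> r" using r by (simp add: q_def field_simps)
      finally show "f \<in> {f. (\<Sum>b\<in>B. f b *\<^sub>R b) \<in> cball 0 r} \<inter> space ?P"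
        using f by (auto simp: space_PiM PiE_def)
    qed
    have "0 < (\<Prod>b\<in>B. emeasure lborel {-q..q})"
      using q B(1) by (auto simp: zero_less_iff_neq_zero)
    also have "\<dots> = emeasure ?P (Pi\<^sub>E B (\<lambda>_. {-q..q}))"
      using B(1) by (intro emeasure_PiM[symmetric]) auto
    also have "\<dots> \<le> emeasure (span_lborel B) (cball 0 r)"
      unfolding emeasure_span_lborel[OF borel_closed[OF closed_cball]]
      using sub measurable_sets[OF measurable_span_lborel_coords[of B] borel_closed[OF closed_cball[of 0 r]]]
      by (intro emeasure_mono) (auto simp: vimage_def)
    finally show ?thesis .
  qed
  show "emeasure (span_lborel B) (cball c r) < \<infinity>" using fin0 tr by simp
  show "emeasure (span_lborel B) (cball c r) > 0" if "r > 0" using pos0[OF that] tr by simp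
  show "measure (span_lborel B) (cball c r) = measure (span_lborel B) (cball 0 r)"
    using tr by (simp add: measure_def)
  show "measure (span_lborel B) (cball c r)
       = (r / s) ^ card B * measure (span_lborel B) (cball c s)" if "r > 0" "s > 0"
  proof -
    have "norm ((r/s) *\<^sub>R x) \<le> r \<longleftrightarrow> norm x \<le> s" for x :: 'a
    proof -
      have "norm ((r/s) *\<^sub>R x) = r * (norm x / s)" using that by simp
      moreover have "r * (norm x / s) \<le> r * 1 \<longleftrightarrow> norm x / s \<le> 1"
        using that by (intro mult_le_cancel_left_pos)
      ultimately show ?thesis using that by simp
    qed
    then have eq: "{x. 0 + (r/s) *\<^sub>R x \<in> cball 0 r} = (cball 0 s :: 'a set)"
      by (simp only: set_eq_iff mem_Collect_eq mem_cball_0 add_0 simp_thms)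
    then have "emeasure (span_lborel B) (cball 0 r)
        = ennreal ((r/s) ^ card B) * emeasure (span_lborel B) (cball 0 s)"
      using emeasure_span_lborel_affine[OF B(1) span_zero, of "r/s" "cball 0 r", unfolded eq] that
      by (simp only: zero_less_divide_iff borel_closed closed_cball simp_thms)
    then show ?thesis using that by (simp add: measure_def tr enn2real_mult)
  qed
qed

subsection \<open>Separated sets and volumes\<close>

text \<open>A separated set of largest cardinality must cover, since an uncovered point could be
  added to it. The largest one exists because total boundedness gives finitely many balls of radius
  r/2, and each of them contains at most one point of a separated set.\<close>

lemma separated_net_exists:
  fixes K :: "'a::metric_space set"
  assumes K: "compact K" and r: "r > 0"
  obtains Z where "finite Z" "Z \<subseteq> K" "pairwise (\<lambda>x y. dist x y > r) Z" "K \<subseteq> (\<Union>z\<in>Z. cball z r)"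
proof -
  obtain C where C: "finite C" "K \<subseteq> (\<Union>c\<in>C. ball c (r/2))"
    using K r unfolding compact_eq_totally_bounded by (metis half_gt_zero)
  define P where "P Z \<longleftrightarrow> finite Z \<and> Z \<subseteq> K \<and> pairwise (\<lambda>x y. dist x y > r) Z" for Z
  have bound: "card Z \<le> card C" if Z: "P Z" for Z
  proof -
    have "\<forall>z\<in>Z. \<exists>c\<in>C. dist c z < r/2"
      using Z C(2) by (force simp: P_def)
    then obtain g where g: "\<And>z. z \<in> Z \<Longrightarrow> g z \<in> C \<and> dist (g z) z < r/2"
      by metis
    have "inj_on g Z"
    proof (rule inj_onI, rule ccontr)
      fix x y assume xy: "x \<in> Z" "y \<in> Z" "g x = g y" "x \<noteq> y"
      have "dist x y \<le> dist (g x) x + dist (g x) y"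
        by (metis dist_commute dist_triangle)
      also have "\<dots> < r"
        using g[OF xy(1)] g[OF xy(2)] xy(3) by simp
      finally show False
        using Z xy by (force simp: P_def pairwise_def)
    qed
    then show ?thesis
      using g C(1) by (metis card_inj_on_le image_subsetI)
  qed
  have "P {}" by (simp add: P_def)
  then obtain Z where Z: "P Z" and max: "\<And>Z'. P Z' \<Longrightarrow> card Z' \<le> card Z"
    using bound ex_has_greatest_nat[of P "{}" card "Suc (card C)"] by (metis less_Suc_eq_le)
  have "K \<subseteq> (\<Union>z\<in>Z. cball z r)"
  proof
    fix x assume x: "x \<in> K"
    show "x \<in> (\<Union>z\<in>Z. cball z r)"
    proof (rule ccontr)
      assume "x \<notin> (\<Union>z\<in>Z. cball z r)"
      then have far: "\<And>z. z \<in> Z \<Longrightarrow> dist z x > r" by (force simp: not_le)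
      then have "x \<notin> Z" using r by force
      moreover have "P (insert x Z)"
        using Z x far by (auto simp: P_def pairwise_insert dist_commute)
      ultimately show False
        using max[of "insert x Z"] Z by (simp add: P_def)
    qed
  qed
  with Z show thesis by (auto simp: P_def intro: that)
qed

text \<open>The balls of radius s/2 around the points are disjoint and lie in a ball of radius R +
  s/2; the bound is the quotient of the volumes.\<close>

lemma card_separated_le:
  fixes Z :: "'a::euclidean_space set"
  assumes Z: "finite Z" "Z \<subseteq> cball 0 R" "pairwise (\<lambda>x y. dist x y > s) Z" and s: "s > 0" and R: "R \<ge> 0"
  shows "real (card Z) \<le> (1 + 2 * R / s) ^ DIM('a)"
proof -
  define v where "v = unit_ball_vol (real DIM('a))"
  have v: "v > 0" unfolding v_def by simp
  have disj: "disjoint_family_on (\<lambda>z. ball z (s/2)) Z"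
  proof (unfold disjoint_family_on_def, intro ballI impI)
    fix x y assume "x \<in> Z" "y \<in> Z" "x \<noteq> y"
    then have "dist x y > s" using Z by (auto simp: pairwise_def)
    then show "ball x (s/2) \<inter> ball y (s/2) = {}"
      by (simp add: disjoint_ballI)
  qed
  have sub: "(\<Union>z\<in>Z. ball z (s/2)) \<subseteq> ball 0 (R + s/2)"
  proof (intro UN_least)
    fix z assume "z \<in> Z"
    then have "norm z \<le> R" using Z by auto
    then show "ball z (s/2) \<subseteq> ball 0 (R + s/2)"
      by (simp add: ball_subset_ball_iff)
  qed
  have "card Z * (v * (s/2) ^ DIM('a)) = (\<Sum>z\<in>Z. measure lborel (ball z (s/2)))"
    using s by (simp add: content_ball v_def)
  also have "\<dots> = measure lborel (\<Union>z\<in>Z. ball z (s/2))"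
    using Z disj by (intro measure_finite_Union[symmetric]) (use emeasure_lborel_ball_finite in \<open>auto simp: less_top[symmetric]\<close>)
  also have "\<dots> \<le> measure lborel (ball (0::'a) (R + s/2))"
    using sub emeasure_lborel_ball_finite[of "0::'a" "R + s/2"]
    by (intro measure_mono_fmeasurable) (auto simp: fmeasurable_def intro!: borel_open open_UN)
  also have "\<dots> = v * (R + s/2) ^ DIM('a)"
    using R s by (simp add: content_ball v_def)
  finally have "card Z * (s/2) ^ DIM('a) \<le> (R + s/2) ^ DIM('a)"
    using v by (simp add: mult.assoc mult.left_commute)
  then have "card Z \<le> (R + s/2) ^ DIM('a) / (s/2) ^ DIM('a)"
    using s by (simp add: field_simps)
  also have "\<dots> = ((R + s/2) / (s/2)) ^ DIM('a)"
    by (rule power_divide[symmetric])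
  also have "(R + s/2) / (s/2) = 1 + 2 * R / s"
    using s by (simp add: field_simps)
  finally show ?thesis .
qed

text \<open>A separated net also covers, so its balls of radius \<open>r\<close> together carry at
  least the volume of the ball of radius \<open>h\<close>. Measuring inside \<open>span B\<close>
  gives the exponent \<open>card B\<close>; the part of a ball outside the span has measure
  zero.\<close>

lemma packing_in_span:
  fixes B :: "'a::euclidean_space set"
  assumes B: "orthonormal B"
    and h: "h > 0" and r: "r > 0"
  obtains Z where "finite Z" "Z \<subseteq> cball 0 h \<inter> span B" "pairwise (\<lambda>x y. dist x y > r) Z"
    "(h / r) ^ card B \<le> real (card Z)"
proof -
  let ?\<nu> = "span_lborel B"
  have K: "compact (cball 0 h \<inter> span B)"
    by (intro compact_Int_closed compact_cball closed_subspace subspace_span)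
  obtain Z where Z: "finite Z" "Z \<subseteq> cball 0 h \<inter> span B" "pairwise (\<lambda>x y. dist x y > r) Z"
      "cball 0 h \<inter> span B \<subseteq> (\<Union>z\<in>Z. cball z r)"
    using separated_net_exists[OF K r] .
  note cb = measure_cball_span_lborel[OF B]
  have fm: "cball z r \<in> fmeasurable ?\<nu>" if "z \<in> Z" for z
    using cb(1)[of z r] Z(2) that by (auto simp: fmeasurable_def)
  have "(h/r) ^ card B * measure ?\<nu> (cball 0 r) = measure ?\<nu> (cball 0 h)"
    using cb(3)[OF span_zero h r] by simp
  also have "\<dots> = measure ?\<nu> (cball 0 h \<inter> span B)"
    by (simp add: measure_def emeasure_span_lborel_Int_span)
  also have "\<dots> \<le> measure ?\<nu> (\<Union>z\<in>Z. cball z r)"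
    using Z fm by (intro measure_mono_fmeasurable fmeasurable.finite_UN)
       (auto simp: closed_subspace borel_closed)
  also have "\<dots> \<le> (\<Sum>z\<in>Z. measure ?\<nu> (cball z r))"
    using Z(1) fm by (intro measure_UNION_le) (auto simp: fmeasurable_def)
  also have "\<dots> = (\<Sum>z\<in>Z. measure ?\<nu> (cball 0 r))"
    using Z(2) by (intro sum.cong refl cb(4)) auto
  also have "\<dots> = card Z * measure ?\<nu> (cball 0 r)" by simp
  finally have "(h / r) ^ card B \<le> real (card Z)"
    using cb(1)[OF span_zero, of r] cb(2)[OF span_zero r]
    by (auto simp: measure_def enn2real_positive_iff)
  with Z show thesis by (auto intro: that)
qed

text \<open>A point of \<open>X\<close> has nonpositive inner product, relative to \<open>c\<close>, with \<open>z\<close> or with \<open>- z\<close>. Moving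
  it by that vector keeps it within \<open>sqrt (\<sigma>\<^sup>2 + h\<^sup>2)\<close> of \<open>c\<close>, instead of only \<open>\<sigma> + h\<close>; this is what
  makes the square root of the dimension, rather than the dimension, appear below.\<close>

lemma measure_le_by_disjoint_translates:
  fixes B :: "'a::euclidean_space set"
  assumes B: "orthonormal B"
    and X: "X \<in> sets borel" "X \<subseteq> cball c \<sigma>" and c: "c \<in> span B" and \<sigma>: "\<sigma> > 0"
    and Z: "finite Z" "Z \<subseteq> cball 0 h \<inter> span B"
    and inj: "\<And>x y z w. \<lbrakk>x \<in> X; y \<in> X; z \<in> Z; w \<in> Z; x - y = z - w\<rbrakk> \<Longrightarrow> z = w"
  shows "card Z * measure (span_lborel B) X \<le> 2 * measure (span_lborel B) (cball c (sqrt (\<sigma>\<^sup>2 + h\<^sup>2)))"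
proof -
  let ?\<nu> = "span_lborel B"
  let ?big = "cball c (sqrt (\<sigma>\<^sup>2 + h\<^sup>2))"
  note cb = measure_cball_span_lborel[OF B c]
  \<comment> \<open>For \<open>e = 1\<close> and \<open>e = -1\<close> these are the two halves of
    \<open>X\<close> cut by the hyperplane through \<open>c\<close> orthogonal to \<open>z\<close>.
    Points of \<open>D e z\<close> are moved by \<open>e *\<^sub>R z\<close>, away from the side
    they lie on.\<close>
  define D where "D e z = X \<inter> {x. e * ((x - c) \<bullet> z) \<le> 0}" for e z
  have Dm: "D e z \<in> sets borel" for e z
    unfolding D_def
    by (intro sets.Int[OF X(1)] borel_closed closed_Collect_le continuous_intros)
  have fmX: "X \<in> fmeasurable ?\<nu>"
    by (rule fmeasurableI2[of "cball c \<sigma>"]) (use cb(1)[of \<sigma>] X in \<open>auto simp: fmeasurable_def\<close>)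
  have fmD: "D e z \<in> fmeasurable ?\<nu>" for e z
    by (rule fmeasurableI2[OF fmX]) (use Dm in \<open>auto simp: D_def\<close>)
  \<comment> \<open>For a fixed sign the translates are disjoint and fit into the big ball. The two
    signs may overlap each other, which accounts for the factor 2.\<close>
  have one: "(\<Sum>z\<in>Z. measure ?\<nu> (D e z)) \<le> measure ?\<nu> ?big" if e: "\<bar>e\<bar> = 1" for e :: real
  proof -
    define T where "T z = {x. - (e *\<^sub>R z) + 1 *\<^sub>R x \<in> D e z}" for z
    have mT: "T z \<in> sets borel" for z
      using measurable_sets_borel[of "\<lambda>x. - (e *\<^sub>R z) + 1 *\<^sub>R x" borel "D e z"] Dm
      by (simp add: vimage_def T_def)
    have eq: "emeasure ?\<nu> (D e z) = emeasure ?\<nu> (T z)" if "z \<in> Z" for z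
    proof -
      have "- (e *\<^sub>R z) \<in> span B"
        using Z that by (auto intro: span_scale span_neg)
      from emeasure_span_lborel_affine[OF orthonormalD(1)[OF B] this, of 1 "D e z"] Dm
      show ?thesis by (simp add: T_def)
    qed
    have fmT: "T z \<in> fmeasurable ?\<nu>" if "z \<in> Z" for z
      using eq[OF that] fmD[of e z] mT by (simp add: fmeasurable_def)
    have sub: "T z \<subseteq> ?big" if "z \<in> Z" for z
    proof
      fix x assume x: "x \<in> T z"
      define y where "y = x - e *\<^sub>R z"
      have y: "y \<in> X" "e * ((y - c) \<bullet> z) \<le> 0"
        using x by (auto simp: T_def D_def y_def)
      have "(norm (u + e *\<^sub>R z))\<^sup>2 = (norm u)\<^sup>2 + 2 * (e * (u \<bullet> z)) + e\<^sup>2 * (norm z)\<^sup>2" for u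
        by (simp only: power2_norm_eq_inner)
           (simp add: inner_add_left inner_add_right inner_commute[of z u] power2_eq_square distrib_left)
      from this[of "y - c"]
      have "(norm (x - c))\<^sup>2 = (norm (y - c))\<^sup>2 + 2 * (e * ((y - c) \<bullet> z)) + e\<^sup>2 * (norm z)\<^sup>2"
        by (simp add: y_def)
      also have "e\<^sup>2 = 1" using e by (metis power2_abs one_power2)
      also have "(norm (y - c))\<^sup>2 + 2 * (e * ((y - c) \<bullet> z)) + 1 * (norm z)\<^sup>2 \<le> \<sigma>\<^sup>2 + h\<^sup>2"
      proof -
        have "norm (y - c) \<le> \<sigma>" using y X(2) by (auto simp: dist_norm norm_minus_commute)
        then have "(norm (y - c))\<^sup>2 \<le> \<sigma>\<^sup>2" by (simp add: power_mono)
        moreover have "norm z \<le> h" using Z \<open>z \<in> Z\<close> by auto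
        then have "(norm z)\<^sup>2 \<le> h\<^sup>2" by (simp add: power_mono)
        ultimately show ?thesis using y by simp
      qed
      finally show "x \<in> ?big"
        by (simp add: dist_norm norm_minus_commute real_le_rsqrt)
    qed
    have disj: "disjoint_family_on T Z"
    proof (unfold disjoint_family_on_def, intro ballI impI)
      fix z w assume zw: "z \<in> Z" "w \<in> Z" "z \<noteq> w"
      show "T z \<inter> T w = {}"
      proof (rule ccontr)
        assume "T z \<inter> T w \<noteq> {}"
        then obtain x where "x \<in> T z" "x \<in> T w" by auto
        then have X2: "x - e *\<^sub>R z \<in> X" "x - e *\<^sub>R w \<in> X"
          by (auto simp: T_def D_def)
        have "e = 1 \<or> e = -1" using e by auto
        then show False
        proof
          assume "e = 1"
          then show False using inj[OF X2(2) X2(1) zw(1,2)] zw by simp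
        next
          assume "e = -1"
          then show False using inj[OF X2(1) X2(2) zw(1,2)] zw by simp
        qed
      qed
    qed
    have "(\<Sum>z\<in>Z. measure ?\<nu> (D e z)) = (\<Sum>z\<in>Z. measure ?\<nu> (T z))"
      using eq by (intro sum.cong) (auto simp: measure_def)
    also have "\<dots> = measure ?\<nu> (\<Union>z\<in>Z. T z)"
      using Z(1) disj fmT by (intro measure_finite_Union[symmetric]) (force simp: fmeasurable_def)+
    also have "\<dots> \<le> measure ?\<nu> ?big"
      using sub mT cb(1)[of "sqrt (\<sigma>\<^sup>2 + h\<^sup>2)"] Z(1)
      by (intro measure_mono_fmeasurable UN_least sets.finite_UN) (auto simp: fmeasurable_def)
    finally show ?thesis .
  qed
  have "measure ?\<nu> X \<le> measure ?\<nu> (D 1 z) + measure ?\<nu> (D (-1) z)" for z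
  proof -
    have "X = D 1 z \<union> D (-1) z" by (auto simp: D_def)
    then show ?thesis using measure_Un_le[of "D 1 z" ?\<nu> "D (-1) z"] Dm by simp
  qed
  then have "(\<Sum>z\<in>Z. measure ?\<nu> X) \<le> (\<Sum>z\<in>Z. measure ?\<nu> (D 1 z) + measure ?\<nu> (D (-1) z))"
    by (intro sum_mono) auto
  also have "\<dots> \<le> 2 * measure ?\<nu> ?big"
    using one[of 1] one[of "-1"] by (simp add: sum.distrib)
  finally show ?thesis by simp
qed

text \<open>Translate \<open>X\<close> by vectors of \<open>span C\<close> that are more than
  \<open>r\<close> apart. A common point of two translates would give two points of \<open>X\<close>
  in one slice at distance more than \<open>r\<close>, so the translates are disjoint, and there are
  at least \<open>(h / r) ^ card C\<close> of them.\<close>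

lemma measure_le_by_slices:
  fixes B C :: "'a::euclidean_space set"
  assumes B: "orthonormal B"
    and C: "orthonormal C" "C \<subseteq> span B"
    and X: "X \<in> sets borel" "X \<subseteq> cball c \<sigma>" and c: "c \<in> span B" and \<sigma>: "\<sigma> > 0" and r: "r > 0"
    and slice: "\<And>x y. \<lbrakk>x \<in> X; y \<in> X; x - y \<in> span C\<rbrakk> \<Longrightarrow> norm (x - y) \<le> r"
    and N: "card B \<le> N" "N > 0"
  shows "measure (span_lborel B) X
      \<le> 2 * exp (1/2) * (r * sqrt N / \<sigma>) ^ card C * measure (span_lborel B) (cball c \<sigma>)"
proof -
  let ?\<nu> = "span_lborel B"
  \<comment> \<open>Longer shifts allow more translates but need a larger enclosing ball. At this
    length the radius grows by sqrt (1 + 1/N), hence the volume by at most sqrt e.\<close>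
  define h where "h = \<sigma> / sqrt N"
  have h: "h > 0" using \<sigma> N by (simp add: h_def)
  obtain Z where Z: "finite Z" "Z \<subseteq> cball 0 h \<inter> span C" "pairwise (\<lambda>x y. dist x y > r) Z"
      and card: "(h / r) ^ card C \<le> real (card Z)"
    using packing_in_span[OF C(1) h r] by blast
  have "span C \<subseteq> span B" using C(2) by (simp add: span_minimal)
  then have Z': "Z \<subseteq> cball 0 h \<inter> span B" using Z(2) by auto
  have inj: "z = w" if "x \<in> X" "y \<in> X" "z \<in> Z" "w \<in> Z" "x - y = z - w" for x y z w
  proof (rule ccontr)
    assume "z \<noteq> w"
    then have "dist z w > r" using Z(3) that by (auto simp: pairwise_def)
    moreover have "x - y \<in> span C" using Z(2) that by (auto intro: span_diff)
    from slice[OF that(1,2) this] have "dist z w \<le> r" using that(5) by (simp add: dist_norm)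
    ultimately show False by simp
  qed
  define q where "q = sqrt (\<sigma>\<^sup>2 + h\<^sup>2) / \<sigma>"
  have q: "q = sqrt (1 + 1 / N)"
  proof -
    have "h\<^sup>2 = \<sigma>\<^sup>2 / N" by (simp add: h_def power_divide)
    then have "\<sigma>\<^sup>2 + h\<^sup>2 = \<sigma>\<^sup>2 * (1 + 1 / N)" by (simp add: distrib_left)
    then have "sqrt (\<sigma>\<^sup>2 + h\<^sup>2) = \<sigma> * sqrt (1 + 1 / N)"
      using \<sigma> by (simp only: real_sqrt_mult real_sqrt_abs abs_of_pos)
    then show ?thesis using \<sigma> by (simp add: q_def)
  qed
  have q1: "q \<ge> 1" unfolding q by simp
  \<comment> \<open>This is (1 + 1/N)^N <= e after a square root; passing to squares avoids
    half-integer powers.\<close>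
  have "q ^ N \<le> exp (1/2)"
  proof -
    have "q\<^sup>2 = 1 + 1 / N" unfolding q by simp
    also have "\<dots> \<le> exp (1 / N)" by (rule exp_ge_add_one_self)
    finally have "(q\<^sup>2) ^ N \<le> exp (1 / N) ^ N"
      by (intro power_mono) auto
    then have "(q ^ N)\<^sup>2 \<le> exp 1"
      using N by (simp add: power_mult[symmetric] mult.commute exp_of_nat_mult[symmetric])
    also have "\<dots> = (exp (1/2))\<^sup>2" by (simp add: exp_of_nat_mult[symmetric] power2_eq_square exp_add[symmetric])
    finally show ?thesis by (rule power2_le_imp_le) simp
  qed
  then have qB: "q ^ card B \<le> exp (1/2)"
    using power_increasing[OF N(1) q1] by simp
  note cb = measure_cball_span_lborel[OF B c]
  have "(h / r) ^ card C * measure ?\<nu> X \<le> card Z * measure ?\<nu> X"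
    using card by (simp add: mult_right_mono)
  also have "\<dots> \<le> 2 * measure ?\<nu> (cball c (sqrt (\<sigma>\<^sup>2 + h\<^sup>2)))"
    by (rule measure_le_by_disjoint_translates[OF B X c \<sigma> Z(1) Z']) (rule inj)
  also have "\<dots> = 2 * (q ^ card B * measure ?\<nu> (cball c \<sigma>))"
    using cb(3)[of "sqrt (\<sigma>\<^sup>2 + h\<^sup>2)" \<sigma>] \<sigma> h by (simp add: q_def add_pos_pos)
  also have "\<dots> \<le> 2 * (exp (1/2) * measure ?\<nu> (cball c \<sigma>))"
    using qB by (intro mult_left_mono mult_right_mono) auto
  finally have *: "(h / r) ^ card C * measure ?\<nu> X \<le> 2 * exp (1/2) * measure ?\<nu> (cball c \<sigma>)"
    by simp
  have "measure ?\<nu> X = (r / h) ^ card C * ((h / r) ^ card C * measure ?\<nu> X)"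
    using h r by (simp add: power_divide)
  also have "\<dots> \<le> (r / h) ^ card C * (2 * exp (1/2) * measure ?\<nu> (cball c \<sigma>))"
    using * h r by (intro mult_left_mono) auto
  also have "r / h = r * sqrt N / \<sigma>" by (simp add: h_def)
  finally show ?thesis by (simp add: mult_ac)
qed

subsection \<open>Frobenius norms and well-conditioned rows\<close>

lemma norm_vec_power2: "(norm (v :: ('a::real_inner)^'n))\<^sup>2 = (\<Sum>i\<in>UNIV. (norm (v $ i))\<^sup>2)"
  by (simp only: power2_norm_eq_inner inner_vec_def)

lemma norm_matrix_power2: "(norm (A :: real^'p^'n))\<^sup>2 = (\<Sum>i\<in>UNIV. \<Sum>j\<in>UNIV. (A $ i $ j)\<^sup>2)"
  by (simp add: norm_vec_power2)

lemma norm_transpose: "norm (transpose A) = norm (A :: real^'p^'n)"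
proof -
  have "(norm (transpose A))\<^sup>2 = (norm A)\<^sup>2"
    unfolding norm_matrix_power2 by (simp add: transpose_def) (rule sum.swap)
  then show ?thesis by simp
qed

lemma norm_matrix_vector_le: "norm ((A :: real^'p^'n) *v x) \<le> norm A * norm x"
proof (rule power2_le_imp_le)
  have "(norm (A *v x))\<^sup>2 = (\<Sum>i\<in>UNIV. (A $ i \<bullet> x)\<^sup>2)"
    by (simp add: norm_vec_power2 matrix_vector_mul_component)
  also have "\<dots> \<le> (\<Sum>i\<in>UNIV. (norm (A $ i))\<^sup>2 * (norm x)\<^sup>2)"
    by (intro sum_mono) (metis Cauchy_Schwarz_ineq power2_norm_eq_inner)
  also have "\<dots> = (norm A * norm x)\<^sup>2"
    by (simp add: norm_vec_power2[of A] power_mult_distrib sum_distrib_right)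
  finally show "(norm (A *v x))\<^sup>2 \<le> (norm A * norm x)\<^sup>2" .
qed simp

lemma matrix_mult_row: "((A :: real^'p^'n) ** (B :: real^'q^'p)) $ i = transpose B *v A $ i"
  by (simp add: vec_eq_iff matrix_matrix_mult_def matrix_vector_mult_def transpose_def mult.commute)

lemma norm_matrix_mult_le: "norm ((A :: real^'p^'n) ** (B :: real^'q^'p)) \<le> norm A * norm B"
proof (rule power2_le_imp_le)
  have "(norm (A ** B))\<^sup>2 = (\<Sum>i\<in>UNIV. (norm (transpose B *v A $ i))\<^sup>2)"
    by (simp add: norm_vec_power2[of "A ** B"] matrix_mult_row)
  also have "\<dots> \<le> (\<Sum>i\<in>UNIV. (norm B * norm (A $ i))\<^sup>2)"
    using norm_matrix_vector_le[of "transpose B"]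
    by (intro sum_mono power_mono) (auto simp: norm_transpose)
  also have "\<dots> = (norm A * norm B)\<^sup>2"
    by (simp add: norm_vec_power2[of A] power_mult_distrib sum_distrib_left mult.commute[of "norm A"])
  finally show "(norm (A ** B))\<^sup>2 \<le> (norm A * norm B)\<^sup>2" .
qed simp

lemma matrix_diff_distrib:
  "(A :: real^'p^'n) ** (B - C) = A ** B - A ** (C :: real^'q^'p)"
  "((A' :: real^'p^'n) - A) ** B = A' ** B - A ** (B :: real^'q^'p)"
  by (simp_all add: vec_eq_iff matrix_matrix_mult_def right_diff_distrib left_diff_distrib sum_subtractf)

text \<open>The rows of \<open>M ** G\<close> are \<open>transpose G\<close> applied to the rows of
  \<open>M\<close>, so it suffices to know that the lower bound for \<open>G\<close> also holds for
  its transpose. This bounds the product of \<open>X\<close> with the inverse of \<open>G\<close>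
  without singular values.\<close>

lemma norm_mult_inverse_le:
  fixes X :: "real^'p^'n" and G :: "real^'p^'p"
  assumes inv: "invertible G" and c: "c > 0" and low: "\<And>x. c * norm x \<le> norm (G *v x)"
    and M: "M ** G = X"
  shows "norm M \<le> norm X / c"
proof -
  obtain H where H: "G ** H = mat 1" using inv by (auto simp: invertible_def)
  \<comment> \<open>With y = G x, the square of |y| equals the inner product of x with the transpose
    of G applied to y, and |x| <= |y| / c.\<close>
  have low': "c * norm y \<le> norm (transpose G *v y)" for y
  proof (cases "y = 0")
    case False
    define x where "x = H *v y"
    have y: "y = G *v x" by (simp add: x_def matrix_vector_mul_assoc H)
    have "(norm y)\<^sup>2 = (G *v x) \<bullet> y" by (metis y power2_norm_eq_inner)
    also have "\<dots> = x \<bullet> (transpose G *v y)"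
      by (metis dot_lmul_matrix inner_commute matrix_transpose_mul transpose_matrix_vector transpose_transpose)
    also have "\<dots> \<le> norm x * norm (transpose G *v y)" by (rule norm_cauchy_schwarz)
    also have "\<dots> \<le> (norm y / c) * norm (transpose G *v y)"
      using low[of x] y c by (intro mult_right_mono) (auto simp: field_simps)
    finally show ?thesis using False c by (simp add: power2_eq_square field_simps)
  qed simp
  have "(c * norm M)\<^sup>2 = (\<Sum>i\<in>UNIV. (c * norm (M $ i))\<^sup>2)"
    by (simp add: power_mult_distrib norm_vec_power2[of M] sum_distrib_left)
  also have "\<dots> \<le> (\<Sum>i\<in>UNIV. (norm (X $ i))\<^sup>2)"
    using low' c by (intro sum_mono power_mono) (auto simp: M[symmetric] matrix_mult_row)
  also have "\<dots> = (norm X)\<^sup>2" by (rule norm_vec_power2[symmetric])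
  finally have "c * norm M \<le> norm X" by (rule power2_le_imp_le) simp
  then show ?thesis using c by (simp add: field_simps)
qed

text \<open>A vector orthogonal to all rows lies in the kernel, so the rows span the whole space and
  a basis can be selected among them.\<close>

lemma exists_nonsingular_rows:
  fixes Y :: "real^'p^'n"
  assumes inj: "\<And>x. Y *v x = 0 \<Longrightarrow> x = 0"
  obtains f :: "'p \<Rightarrow> 'n" where "det (\<chi> i. Y $ f i) \<noteq> 0"
proof -
  let ?S = "range (\<lambda>a. Y $ a)"
  have sp: "span ?S = UNIV"
  proof (rule ccontr)
    assume "span ?S \<noteq> UNIV"
    then obtain x where x: "x \<noteq> 0" "\<forall>y\<in>span ?S. x \<bullet> y = 0"
      using span_not_UNIV_orthogonal by blast
    have "x \<bullet> Y $ i = 0" for i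
      using x(2) by (blast intro: span_base)
    then have "Y *v x = 0"
      by (simp add: vec_eq_iff matrix_vector_mul_component inner_commute[of _ x])
    with inj x(1) show False by blast
  qed
  obtain B where B: "B \<subseteq> ?S" "independent B" "?S \<subseteq> span B" "card B = dim ?S"
    by (rule basis_exists)
  have cB: "card B = CARD('p)"
    using B(4) sp by (metis dim_UNIV dim_span DIM_cart DIM_real mult.right_neutral)
  then obtain g where g: "bij_betw g (UNIV :: 'p set) B"
    using finite_same_card_bij[of "UNIV :: 'p set" B] independent_imp_finite[OF B(2)] by auto
  have "\<forall>i. \<exists>a. Y $ a = g i"
    using bij_betw_apply[OF g] B(1) by (metis UNIV_I image_iff subset_iff)
  then obtain f where f: "\<And>i. Y $ f i = g i" by metis
  define G where "G = (\<chi> i. Y $ f i)"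
  have "rows G = B"
    using g f by (auto simp: rows_def row_def G_def bij_betw_def)
  moreover have "span B = UNIV"
    using sp B(3) by (metis span_minimal subspace_span top.extremum_uniqueI)
  ultimately have "invertible G"
    using matrix_left_invertible_span_rows[of G] matrix_left_right_inverse[of _ G]
    by (auto simp: invertible_def)
  then have "det G \<noteq> 0" by (simp add: invertible_det_nz)
  then show thesis using that by (simp add: G_def)
qed

lemma bounded_row_coordinates:
  fixes Y :: "real^'p^'n"
  assumes inj: "\<And>x. Y *v x = 0 \<Longrightarrow> x = 0"
  obtains f :: "'p \<Rightarrow> 'n" and W :: "real^'p^'n" where
    "invertible (\<chi> i. Y $ f i)" "W ** (\<chi> i. Y $ f i) = Y"
    "\<And>i. W $ f i = axis i 1" "\<And>a j. \<bar>W $ a $ j\<bar> \<le> 1"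
proof -
  \<comment> \<open>The competitors are all maps, not only injective ones: a repeated row gives
    determinant 0, and the row replacement below can then be compared without a case
    distinction.\<close>
  define d where "d f = \<bar>det (\<chi> i. Y $ f i)\<bar>" for f :: "'p \<Rightarrow> 'n"
  obtain f where f: "\<And>g. d g \<le> d f"
  proof -
    have "finite (range d)" by simp
    then have "Max (range d) \<in> range d" by (intro Max_in) auto
    then obtain f where "d f = Max (range d)" by (metis imageE)
    then show thesis using that[of f] by simp
  qed
  define G where "G = (\<chi> i. Y $ f i)"
  obtain f0 :: "'p \<Rightarrow> 'n" where "det (\<chi> i. Y $ f0 i) \<noteq> 0"
    using exists_nonsingular_rows[OF inj] by blast
  then have "0 < d f0" by (simp add: d_def)
  also have "\<dots> \<le> d f" by (rule f)
  finally have det: "det G \<noteq> 0" by (simp add: d_def G_def)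
  then have "invertible G" by (simp add: invertible_det_nz)
  then obtain H where H: "G ** H = mat 1" "H ** G = mat 1" by (auto simp: invertible_def)
  define W where "W = Y ** H"
  have WG: "W ** G = Y" by (simp add: W_def matrix_mul_assoc[symmetric] H)
  have Wf: "W $ f i = axis i 1" for i
  proof -
    have "W $ f i = (G ** H) $ i" by (simp add: W_def matrix_mult_row G_def)
    then show ?thesis by (simp add: H mat_def axis_def vec_eq_iff)
  qed
  have "\<bar>W $ a $ k\<bar> \<le> 1" for a k
  proof -
    have "(\<Sum>i\<in>UNIV. W $ a $ i *s row i G) = (W ** G) $ a"
      by (simp add: vec_eq_iff row_def matrix_matrix_mult_def)
    then have row: "(\<Sum>i\<in>UNIV. W $ a $ i *s row i G) = Y $ a" by (simp add: WG)
    \<comment> \<open>Row \<open>a\<close> of \<open>Y\<close> is the combination of the chosen rows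
      with coefficients \<open>W $ a\<close>. By Cramer, coefficient \<open>k\<close> is the
      quotient of two determinants, the numerator being that of the competitor
      \<open>f(k := a)\<close>.\<close>
    have "W $ a $ k * det G =
        det ((\<chi> i. if i = k then (\<Sum>i\<in>UNIV. W $ a $ i *s row i G) else row i G) :: real^'p^'p)"
      by (rule cramer_lemma_transpose[symmetric])
    also have "\<dots> = det (\<chi> i. Y $ (f(k := a)) i)"
      unfolding row by (rule arg_cong[where f=det]) (simp add: vec_eq_iff row_def G_def)
    finally have "\<bar>W $ a $ k\<bar> * d f = d (f(k := a))"
      by (simp add: d_def G_def abs_mult[symmetric])
    also have "\<dots> \<le> d f" by (rule f)
    finally show ?thesis using det by (simp add: d_def G_def)
  qed
  with \<open>invertible G\<close> WG Wf show thesis by (intro that[of f W]) (auto simp: G_def)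
qed

lemma inj_if_axis_rows:
  fixes W :: "real^'p^'n"
  assumes "\<And>i. W $ f i = axis i 1"
  shows "inj f"
proof (rule injI)
  fix i j assume "f i = f j"
  then have "axis i (1::real) = axis j 1" using assms by metis
  then show "i = j" by (simp add: axis_eq_axis)
qed

text \<open>The p chosen rows are unit vectors and contribute p; each of the other n - p rows has p
  entries bounded by 1.\<close>

lemma norm_bounded_row_coordinates:
  fixes W :: "real^'p^'n"
  assumes Wf: "\<And>i. W $ f i = axis i 1" and W1: "\<And>a j. \<bar>W $ a $ j\<bar> \<le> 1"
  shows "(norm W)\<^sup>2 \<le> real CARD('p) * (real CARD('n) - real CARD('p) + 1)"
proof -
  have inj: "inj f" by (rule inj_if_axis_rows[OF Wf])
  have cr: "card (range f) = CARD('p)" using inj by (simp add: card_image)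
  have "CARD('p) \<le> CARD('n)"
    using cr card_mono[of "UNIV :: 'n set" "range f"] by simp
  have "(norm W)\<^sup>2 = (\<Sum>a\<in>UNIV. (norm (W $ a))\<^sup>2)" by (rule norm_vec_power2)
  also have "\<dots> = (\<Sum>a\<in>range f. (norm (W $ a))\<^sup>2) + (\<Sum>a\<in>-range f. (norm (W $ a))\<^sup>2)"
    by (subst sum.union_disjoint[symmetric]) auto
  also have "(\<Sum>a\<in>range f. (norm (W $ a))\<^sup>2) = (\<Sum>a\<in>range f. 1)"
    by (intro sum.cong refl) (auto simp: Wf)
  also have "(\<Sum>a\<in>-range f. (norm (W $ a))\<^sup>2) \<le> (\<Sum>a\<in>-range f. real CARD('p))"
  proof (intro sum_mono)
    fix a
    have "(norm (W $ a))\<^sup>2 = (\<Sum>j\<in>UNIV. (W $ a $ j)\<^sup>2)" by (simp add: norm_vec_power2)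
    also have "\<dots> \<le> (\<Sum>j\<in>(UNIV::'p set). 1)"
      using W1 by (intro sum_mono) (simp add: abs_square_le_1)
    finally show "(norm (W $ a))\<^sup>2 \<le> real CARD('p)" by simp
  qed
  also have "(\<Sum>a\<in>-range f. real CARD('p)) = (real CARD('n) - real CARD('p)) * real CARD('p)"
    using cr \<open>CARD('p) \<le> CARD('n)\<close> by (simp add: Compl_eq_Diff_UNIV card_Diff_subset of_nat_diff)
  finally show ?thesis using cr by (simp add: algebra_simps)
qed

text \<open>Two symmetric matrices that differ only in one principal block and are both almost singular
  are close: since \<open>W\<close> and \<open>W'\<close> restrict to the identity on the block,
  \<open>W'\<^sup>T (S' - S) W\<close> is the difference of the blocks.\<close>

lemma norm_block_difference_le:
  fixes W W' :: "real^'p^'n" and S S' :: "real^'n^'n"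
  assumes Wf: "\<And>i. W $ f i = axis i 1" "\<And>i. W' $ f i = axis i 1"
    and w: "norm W \<le> w" "norm W' \<le> w" and a: "norm (S ** W) \<le> a" "norm (S' ** W') \<le> a"
    and S': "S' \<in> sym_mats"
    and block: "\<And>x y. x \<notin> range f \<or> y \<notin> range f \<Longrightarrow> (S' - S) $ x $ y = 0"
  shows "norm (S' - S) \<le> 2 * a * w"
proof -
  define D where "D = S' - S"
  have inj: "inj f" by (rule inj_if_axis_rows[OF Wf(1)])
  have entry: "W $ f i $ j = of_bool (i = j)" "W' $ f i $ j = of_bool (i = j)" for i j
    by (auto simp: Wf axis_def)
  have sub: "(\<Sum>x\<in>UNIV. g x) = (\<Sum>i\<in>UNIV. g (f i))" if "\<And>x. x \<notin> range f \<Longrightarrow> g x = 0" for g :: "'n \<Rightarrow> real"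
  proof -
    have "(\<Sum>x\<in>UNIV. g x) = (\<Sum>x\<in>range f. g x)"
      using that by (intro sum.mono_neutral_right) auto
    then show ?thesis using inj by (simp add: sum.reindex)
  qed
  \<comment> \<open>\<open>D\<close> vanishes off the block and \<open>W\<close> is the identity on
    it, so multiplying by \<open>W\<close> only selects the block columns.\<close>
  have DW: "(D ** W) $ x $ j = D $ x $ f j" for x j
  proof -
    have "(D ** W) $ x $ j = (\<Sum>y\<in>UNIV. D $ x $ y * W $ y $ j)"
      by (simp add: matrix_matrix_mult_def)
    also have "\<dots> = (\<Sum>i\<in>UNIV. D $ x $ f i * W $ f i $ j)"
      using block by (intro sub) (simp add: D_def)
    finally show ?thesis by (simp add: entry of_bool_def if_distrib cong: if_cong)
  qed
  have WDW: "(transpose W' ** (D ** W)) $ i $ j = D $ f i $ f j" for i j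
  proof -
    have "(transpose W' ** (D ** W)) $ i $ j = (\<Sum>x\<in>UNIV. W' $ x $ i * (D ** W) $ x $ j)"
      by (simp add: matrix_matrix_mult_def transpose_def)
    also have "\<dots> = (\<Sum>x\<in>UNIV. W' $ x $ i * D $ x $ f j)" by (simp add: DW)
    also have "\<dots> = (\<Sum>k\<in>UNIV. W' $ f k $ i * D $ f k $ f j)"
      using block by (intro sub) (simp add: D_def)
    finally show ?thesis by (simp add: entry of_bool_def if_distrib if_distribR cong: if_cong)
  qed
  have "(norm D)\<^sup>2 = (\<Sum>x\<in>UNIV. \<Sum>y\<in>UNIV. (D $ x $ y)\<^sup>2)" by (rule norm_matrix_power2)
  also have "\<dots> = (\<Sum>i\<in>UNIV. \<Sum>y\<in>UNIV. (D $ f i $ y)\<^sup>2)"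
    using block by (intro sub) (simp add: D_def)
  also have "\<dots> = (\<Sum>i\<in>UNIV. \<Sum>j\<in>UNIV. (D $ f i $ f j)\<^sup>2)"
    using block by (intro sum.cong refl sub) (simp add: D_def)
  also have "\<dots> = (norm (transpose W' ** (D ** W)))\<^sup>2"
    unfolding norm_matrix_power2 WDW ..
  finally have "norm D = norm (transpose W' ** (D ** W))" by simp
  \<comment> \<open>Symmetry of \<open>S'\<close> moves it next to \<open>W'\<close>, so that both
    terms contain a product assumed to be small.\<close>
  also have "transpose W' ** (D ** W) = transpose (S' ** W') ** W - transpose W' ** (S ** W)"
    using S' by (simp add: D_def sym_mats_def matrix_transpose_mul matrix_mul_assoc
      matrix_diff_distrib)
  also have "norm \<dots> \<le> norm (transpose (S' ** W') ** W) + norm (transpose W' ** (S ** W))"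
    by (rule norm_triangle_ineq4)
  also have "\<dots> \<le> norm (S' ** W') * norm W + norm W' * norm (S ** W)"
    by (intro add_mono) (metis norm_matrix_mult_le norm_transpose)+
  also have "\<dots> \<le> a * w + w * a"
    using a w norm_ge_zero order_trans by (intro add_mono mult_mono) (auto intro: order_trans[OF norm_ge_zero])
  finally show ?thesis by (simp add: D_def algebra_simps)
qed

subsection \<open>Spurious points make the slack matrix nearly singular\<close>

lemma meas_adj_inner: "meas_adj A l \<bullet> X = l \<bullet> meas_map A X"
  by (simp add: meas_adj_def meas_map_def inner_sum_left inner_vec_def[of l])

lemma norm_meas_map_le_norm: "norm (meas_map A X) \<le> norm A * norm X"
proof (rule power2_le_imp_le)
  have "(norm (meas_map A X))\<^sup>2 = (\<Sum>i\<in>UNIV. (A $ i \<bullet> X)\<^sup>2)"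
    by (simp add: norm_vec_power2 meas_map_def)
  also have "\<dots> \<le> (\<Sum>i\<in>UNIV. (norm (A $ i))\<^sup>2 * (norm X)\<^sup>2)"
    by (intro sum_mono) (metis Cauchy_Schwarz_ineq power2_norm_eq_inner)
  also have "\<dots> = (norm A * norm X)\<^sup>2"
    by (simp add: norm_vec_power2[of A] power_mult_distrib sum_distrib_right)
  finally show "(norm (meas_map A X))\<^sup>2 \<le> (norm A * norm X)\<^sup>2" .
qed simp

lemma bounded_linear_meas_map: "bounded_linear (meas_map A)"
proof (rule bounded_linear_intro)
  show "norm (meas_map A X) \<le> norm X * norm A" for X
    using norm_meas_map_le_norm[of A X] by (simp add: mult.commute)
qed (simp_all add: meas_map_def vec_eq_iff inner_add_right)

text \<open>The Euclidean norm of a tuple dominates its operator norm, so a perturbation of size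
  \<open>\<sigma>\<close> costs at most \<open>\<sigma>\<close>. This makes R_A a bound valid for
  every sample.\<close>

lemma norm_meas_map_cball_le:
  assumes "A \<in> cball Abar \<sigma>"
  shows "norm (meas_map A X) \<le> (onorm (meas_map Abar) + \<sigma>) * norm X"
proof -
  have "meas_map A X = meas_map Abar X + meas_map (A - Abar) X"
    by (simp add: meas_map_def vec_eq_iff inner_diff_left)
  also have "norm \<dots> \<le> norm (meas_map Abar X) + norm (meas_map (A - Abar) X)"
    by (rule norm_triangle_ineq)
  also have "\<dots> \<le> onorm (meas_map Abar) * norm X + \<sigma> * norm X"
  proof (rule add_mono)
    show "norm (meas_map Abar X) \<le> onorm (meas_map Abar) * norm X"
      by (rule onorm[OF bounded_linear_meas_map])
    have "norm (A - Abar) \<le> \<sigma>" using assms by (simp add: dist_norm norm_minus_commute)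
    then have "norm (A - Abar) * norm X \<le> \<sigma> * norm X" by (rule mult_right_mono) simp
    then show "norm (meas_map (A - Abar) X) \<le> \<sigma> * norm X"
      using norm_meas_map_le_norm[of "A - Abar" X] by linarith
  qed
  finally show ?thesis by (simp add: distrib_right)
qed

lemma norm_meas_adj_le:
  assumes "\<And>X. norm (meas_map A X) \<le> R * norm X"
  shows "norm (meas_adj A l) \<le> R * norm l"
proof (cases "meas_adj A l = 0")
  case True
  \<comment> \<open>Any nonzero matrix serves here to force R >= 0.\<close>
  have "0 \<le> R * norm (axis undefined (axis undefined 1) :: real^'a^'a)"
    using assms[of "axis undefined (axis undefined 1)"] norm_ge_zero order_trans by blast
  then have "R \<ge> 0" by simp
  then show ?thesis using True by simp
next
  case False
  let ?X = "meas_adj A l"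
  have "(norm ?X)\<^sup>2 = l \<bullet> meas_map A ?X" by (simp add: power2_norm_eq_inner meas_adj_inner)
  also have "\<dots> \<le> norm l * norm (meas_map A ?X)" by (rule norm_cauchy_schwarz)
  also have "\<dots> \<le> norm l * (R * norm ?X)" by (intro mult_left_mono assms) simp
  finally show ?thesis using False by (simp add: power2_eq_square mult_ac)
qed

lemma meas_adj_sym: "A \<in> sym_tuples \<Longrightarrow> meas_adj A l \<in> sym_mats"
  by (auto simp: sym_tuples_def sym_mats_def meas_adj_def vec_eq_iff transpose_def)

lemma slack_eq_meas_adj: "slack A b X = meas_adj A (2 *\<^sub>R (meas_map A X - b))"
  by (simp add: slack_def meas_adj_def scaleR_sum_right)

lemma psd_mult_transpose: "psd (Y ** transpose Y)"
proof -
  have "v \<bullet> ((Y ** transpose Y) *v v) = (transpose Y *v v) \<bullet> (transpose Y *v v)" for v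
    by (metis dot_lmul_matrix matrix_vector_mul_assoc transpose_matrix_vector)
  then show ?thesis
    by (simp add: psd_def sym_mats_def matrix_transpose_mul)
qed

definition outer :: "real^'n \<Rightarrow> real^'p \<Rightarrow> real^'p^'n" where
  "outer v x = (\<chi> i j. v $ i * x $ j)"

lemma norm_outer: "norm (outer v x) = norm v * norm x"
proof -
  have "(norm (outer v x))\<^sup>2 = (norm v * norm x)\<^sup>2"
    unfolding norm_matrix_power2
    by (simp add: outer_def power_mult_distrib norm_vec_power2[of v] norm_vec_power2[of x] sum_product)
  then show ?thesis by simp
qed

lemma outer_mult_transpose: "outer v x ** transpose Y = outer v (Y *v x)"
  by (simp add: vec_eq_iff outer_def matrix_matrix_mult_def transpose_def
      matrix_vector_mult_def sum_distrib_left mult_ac)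

lemma inner_outer: "S \<bullet> outer v x = v \<bullet> (S *v x)"
  by (simp add: inner_vec_def outer_def matrix_vector_mult_def sum_distrib_left mult_ac)

lemma outer_scaleR_right: "outer v (c *\<^sub>R x) = c *\<^sub>R outer v x"
  by (simp add: vec_eq_iff outer_def)

lemma outer_gram: "outer v x ** transpose (outer v x) = (norm x)\<^sup>2 *\<^sub>R outer v v"
proof -
  have "outer v x *v x = (norm x)\<^sup>2 *\<^sub>R v"
    by (simp add: vec_eq_iff outer_def matrix_vector_mult_def power2_norm_eq_inner inner_vec_def
        sum_distrib_left mult_ac)
  then show ?thesis by (simp add: outer_mult_transpose outer_scaleR_right)
qed

text \<open>Y Y^T is always positive semidefinite, and |S Y Y^T| <= |S Y| |Y| already meets the
  first-order tolerance. Only a large residual and a very negative direction of S remain as reasons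
  for failure.\<close>

lemma not_approx_optimal_iff:
  fixes Y :: "real^'p^'n" and A :: "(real^'n^'n)^'m"
  assumes A: "A \<in> sym_tuples" and crit: "norm (slack A b (Y ** transpose Y) ** Y) \<le> e1"
    and RY: "norm Y \<le> RY"
  shows "\<not> approx_optimal A b e0 (RY * e1) e (Y ** transpose Y) \<longleftrightarrow>
    e0 < norm (meas_map A (Y ** transpose Y) - b) \<and>
    (\<exists>v. norm v = 1 \<and> v \<bullet> (slack A b (Y ** transpose Y) *v v) < - e)"
proof -
  define S where "S = slack A b (Y ** transpose Y)"
  have "norm (S ** (Y ** transpose Y)) \<le> norm (S ** Y) * norm Y"
    using norm_matrix_mult_le[of "S ** Y" "transpose Y"] by (simp add: matrix_mul_assoc norm_transpose)
  also have "\<dots> \<le> e1 * RY"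
    using crit RY unfolding S_def by (intro mult_mono) (auto intro: order_trans[OF norm_ge_zero])
  finally have "norm (S ** (Y ** transpose Y)) \<le> RY * e1" by (simp add: mult.commute)
  moreover have "\<not> loewner_le (- e *\<^sub>R mat 1) S \<longleftrightarrow> (\<exists>v. norm v = 1 \<and> v \<bullet> (S *v v) < - e)"
  proof -
    have sym: "S - (- e) *\<^sub>R mat 1 \<in> sym_mats"
      using meas_adj_sym[OF A] unfolding S_def slack_eq_meas_adj
      by (auto simp: sym_mats_def transpose_def vec_eq_iff mat_def)
    have form: "v \<bullet> ((S - (- e) *\<^sub>R mat 1) *v v) = v \<bullet> (S *v v) + e * (norm v)\<^sup>2" for v
      by (simp add: matrix_vector_mult_add_rdistrib scaleR_matrix_vector_assoc[symmetric]
        inner_add_right power2_norm_eq_inner)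
    show ?thesis
    proof
      assume "\<not> loewner_le (- e *\<^sub>R mat 1) S"
      then obtain v where v: "v \<bullet> (S *v v) + e * (norm v)\<^sup>2 < 0"
        using sym by (auto simp: loewner_le_def psd_def not_le form simp del: scaleR_minus_left)
      then have v0: "v \<noteq> 0" by auto
      define w where "w = (1 / norm v) *\<^sub>R v"
      have "w \<bullet> (S *v w) = (v \<bullet> (S *v v)) / (norm v)\<^sup>2"
        by (simp add: w_def matrix_vector_mult_scaleR power2_eq_square)
      also have "\<dots> < - e" using v v0 by (simp add: field_simps)
      finally show "\<exists>v. norm v = 1 \<and> v \<bullet> (S *v v) < - e"
        using v0 by (intro exI[of _ w]) (simp add: w_def)
    next
      assume "\<exists>v. norm v = 1 \<and> v \<bullet> (S *v v) < - e"
      then obtain v where v: "norm v = 1" "v \<bullet> (S *v v) < - e" by blast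
      then have "\<not> 0 \<le> v \<bullet> ((S - (- e) *\<^sub>R mat 1) *v v)" by (simp only: form) simp
      then show "\<not> loewner_le (- e *\<^sub>R mat 1) S"
        unfolding loewner_le_def psd_def by blast
    qed
  qed
  ultimately show ?thesis
    using psd_mult_transpose[of Y] by (auto simp: approx_optimal_def S_def not_le)
qed

lemma spurious_AC_iff:
  fixes Y :: "real^'p^'n" and A :: "(real^'n^'n)^'m"
  assumes "A \<in> sym_tuples"
  shows "spurious_AC A b RY e0 e1 e2 Y \<longleftrightarrow> approx_2_critical A b e1 e2 Y \<and> norm Y \<le> RY \<and>
    e0 < norm (meas_map A (Y ** transpose Y) - b) \<and>
    (\<exists>v. norm v = 1 \<and> v \<bullet> (slack A b (Y ** transpose Y) *v v) < - (5 * e2))"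
  unfolding spurious_AC_def
  using not_approx_optimal_iff[OF assms, of b Y e1 RY e0 "5 * e2"]
  by (auto simp: approx_2_critical_def)

text \<open>If \<open>Y\<close> shrinks some \<open>x\<close> by more than \<open>sqrt e2 / R\<close>, then second-order criticality
  in the rank-one direction \<open>U = v x\<^sup>T\<close> contradicts the very negative curvature of the slack
  matrix at \<open>v\<close>.\<close>

lemma spurious_AC_norm_ge:
  fixes Y :: "real^'p^'n" and A :: "(real^'n^'n)^'m"
  assumes sp: "spurious_AC A b RY e0 e1 e2 Y" and A: "A \<in> sym_tuples" and e2: "e2 > 0"
    and R: "R > 0" "\<And>X. norm (meas_map A X) \<le> R * norm X"
  shows "sqrt e2 / R * norm x \<le> norm (Y *v x)"
proof (rule ccontr)
  define S where "S = slack A b (Y ** transpose Y)"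
  have crit2: "S \<bullet> (U ** transpose U) + 4 * (norm (meas_map A (U ** transpose Y)))\<^sup>2 \<ge> - e2"
    if "norm U = 1" for U :: "real^'p^'n"
    using sp that by (auto simp: spurious_AC_def approx_2_critical_def S_def)
  obtain v where v: "norm v = 1" "v \<bullet> (S *v v) < - (5 * e2)"
    using sp[unfolded spurious_AC_iff[OF A]] by (auto simp: S_def)
  assume small: "\<not> sqrt e2 / R * norm x \<le> norm (Y *v x)"
  then have x0: "x \<noteq> 0" by auto
  define y where "y = (1 / norm x) *\<^sub>R x"
  have y: "norm y = 1" "R * norm (Y *v y) \<le> sqrt e2"
    using x0 small R(1) by (auto simp: y_def matrix_vector_mult_scaleR field_simps)
  define U where "U = outer v y"
  have U1: "norm U = 1" using v y by (simp add: U_def norm_outer)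
  have 1: "S \<bullet> (U ** transpose U) < - (5 * e2)"
    using v y by (simp add: U_def outer_gram inner_outer)
  have "norm (meas_map A (U ** transpose Y)) \<le> R * norm (U ** transpose Y)" by (rule R(2))
  also have "\<dots> \<le> sqrt e2" using v y by (simp add: U_def outer_mult_transpose norm_outer)
  finally have "(norm (meas_map A (U ** transpose Y)))\<^sup>2 \<le> (sqrt e2)\<^sup>2"
    by (intro power_mono) auto
  then have "(norm (meas_map A (U ** transpose Y)))\<^sup>2 \<le> e2" using e2 by simp
  \<comment> \<open>The curvature is below -5 e2 + 4 e2 = -e2. This is the origin of the factor 5 in
    the notion of spurious point.\<close>
  with 1 crit2[OF U1] e2 show False by simp
qed

text \<open>\<open>l\<close> is a free parameter here, decoupled from the residual of any particular
  Y. Thus for fixed \<open>l\<close> and \<open>f\<close> the tuple enters only through the linear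
  expression \<open>meas_adj A l\<close>, and \<open>W\<close> is Y with its scale removed.\<close>

definition near_singular :: "real^'m \<Rightarrow> ('p::finite \<Rightarrow> 'n::finite) \<Rightarrow> real \<Rightarrow> ((real^'n^'n)^'m) set" where
  "near_singular l f t = {A. \<exists>W :: real^'p^'n. (\<forall>i. W $ f i = axis i 1) \<and>
     (\<forall>a j. \<bar>W $ a $ j\<bar> \<le> 1) \<and> norm (meas_adj A l ** W) \<le> t * norm W}"

lemma spurious_AC_imp_near_singular:
  fixes Y :: "real^'p^'n" and A :: "(real^'n^'n)^'m"
  assumes sp: "spurious_AC A b RY e0 e1 e2 Y" and A: "A \<in> sym_tuples" and e2: "e2 > 0"
    and R: "R > 0" "\<And>X. norm (meas_map A X) \<le> R * norm X"
  obtains l and f :: "'p::finite \<Rightarrow> 'n::finite" where "2 * e0 < norm l" "norm l \<le> 2 * (R * RY\<^sup>2 + norm b)"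
    "A \<in> near_singular l f (e1 * R / sqrt e2)"
proof -
  have D: "e0 < norm (meas_map A (Y ** transpose Y) - b)" "norm Y \<le> RY"
    "norm (slack A b (Y ** transpose Y) ** Y) \<le> e1"
    using sp[unfolded spurious_AC_iff[OF A]] by (auto simp: approx_2_critical_def)
  \<comment> \<open>The factor 2 in the slack matrix is kept inside \<open>l\<close>, so a residual
    above e0 gives |l| > 2 e0.\<close>
  define l where "l = 2 *\<^sub>R (meas_map A (Y ** transpose Y) - b)"
  have S: "slack A b (Y ** transpose Y) = meas_adj A l"
    by (simp add: slack_eq_meas_adj l_def)
  define s where "s = sqrt e2 / R"
  have s: "s > 0" using R(1) e2 by (simp add: s_def)
  have low: "s * norm x \<le> norm (Y *v x)" for x using spurious_AC_norm_ge[OF assms] by (simp add: s_def)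
  have inj: "x = 0" if "Y *v x = 0" for x
    using low[of x] that s by (simp add: mult_le_0_iff)
  obtain f :: "'p \<Rightarrow> 'n" and W :: "real^'p^'n" where
    W: "invertible (\<chi> i. Y $ f i)" "W ** (\<chi> i. Y $ f i) = Y"
      "\<And>i. W $ f i = axis i 1" "\<And>a j. \<bar>W $ a $ j\<bar> \<le> 1"
    using bounded_row_coordinates[OF inj] by metis
  define G where "G = (\<chi> i. Y $ f i)"
  have "W $ f undefined \<noteq> 0" using W(3) by (simp add: axis_eq_0_iff)
  then have W0: "norm W > 0" by auto
  \<comment> \<open>Y = W G, so a lower bound s for Y leaves at least s / |W| for G. Dividing |S Y|
    <= e1 by it produces the factor |W| in \<open>near_singular\<close>.\<close>
  have "s / norm W * norm x \<le> norm (G *v x)" for x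
  proof -
    have "Y *v x = W *v (G *v x)" using W(2) by (simp add: matrix_vector_mul_assoc G_def)
    then have "s * norm x \<le> norm W * norm (G *v x)"
      using low[of x] norm_matrix_vector_le[of W "G *v x"] by simp
    then show ?thesis using W0 by (simp add: field_simps)
  qed
  moreover have "(meas_adj A l ** W) ** G = meas_adj A l ** Y"
    using W(2) by (simp add: matrix_mul_assoc[symmetric] G_def)
  ultimately have "norm (meas_adj A l ** W) \<le> norm (meas_adj A l ** Y) / (s / norm W)"
    using W(1) W0 s by (intro norm_mult_inverse_le[of G]) (auto simp: G_def)
  also have "\<dots> \<le> e1 / (s / norm W)"
    using D(3) s W0 by (intro divide_right_mono) (auto simp: S)
  also have "\<dots> = e1 * R / sqrt e2 * norm W" using R(1) e2 by (simp add: s_def)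
  finally have "A \<in> near_singular l f (e1 * R / sqrt e2)"
    using W(3,4) by (auto simp: near_singular_def)
  moreover have "2 * e0 < norm l" using D(1) by (simp add: l_def)
  moreover have "norm l \<le> 2 * (R * RY\<^sup>2 + norm b)"
  proof -
    have "norm (meas_map A (Y ** transpose Y) - b) \<le> norm (meas_map A (Y ** transpose Y)) + norm b"
      by (rule norm_triangle_ineq4)
    also have "norm (meas_map A (Y ** transpose Y)) \<le> R * norm (Y ** transpose Y)" by (rule R(2))
    also have "norm (Y ** transpose Y) \<le> norm Y * norm Y"
      using norm_matrix_mult_le[of Y "transpose Y"] by (simp add: norm_transpose)
    also have "\<dots> \<le> RY\<^sup>2"
      using D(2) unfolding power2_eq_square by (intro mult_mono) (auto intro: order_trans[OF norm_ge_zero])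
    finally show ?thesis using R(1) by (simp add: l_def)
  qed
  ultimately show thesis by (intro that)
qed

lemma near_singular_mono:
  fixes f :: "'p::finite \<Rightarrow> 'n::finite"
  assumes "t \<le> t'"
  shows "near_singular l f t \<subseteq> near_singular l f t'"
proof
  fix A assume "A \<in> near_singular l f t"
  then obtain W :: "real^'p^'n" where W: "\<forall>i. W $ f i = axis i 1" "\<forall>a j. \<bar>W $ a $ j\<bar> \<le> 1"
      "norm (meas_adj A l ** W) \<le> t * norm W"
    by (auto simp: near_singular_def)
  have "t * norm W \<le> t' * norm W" using assms by (rule mult_right_mono) simp
  with W show "A \<in> near_singular l f t'"
    unfolding near_singular_def by (intro CollectI exI[of _ W]) auto
qed

text \<open>The same \<open>W\<close> still works: only \<open>meas_adj A l\<close> changes, by at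
  most R |l - l'|.\<close>

lemma near_singular_perturb:
  fixes f :: "'p::finite \<Rightarrow> 'n::finite"
  assumes A: "A \<in> near_singular l f t" and R: "\<And>X. norm (meas_map A X) \<le> R * norm X"
    and l': "R * dist l l' \<le> t'"
  shows "A \<in> near_singular l' f (t + t')"
proof -
  from A obtain W :: "real^'p^'n" where W: "\<forall>i. W $ f i = axis i 1" "\<forall>a j. \<bar>W $ a $ j\<bar> \<le> 1"
      "norm (meas_adj A l ** W) \<le> t * norm W"
    by (auto simp: near_singular_def)
  have "meas_adj A l' ** W = meas_adj A l ** W - meas_adj A (l - l') ** W"
    by (simp add: meas_adj_def scaleR_diff_left sum_subtractf matrix_diff_distrib[symmetric])
  also have "norm \<dots> \<le> norm (meas_adj A l ** W) + norm (meas_adj A (l - l') ** W)"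
    by (rule norm_triangle_ineq4)
  also have "norm (meas_adj A (l - l') ** W) \<le> norm (meas_adj A (l - l')) * norm W"
    by (rule norm_matrix_mult_le)
  also have "\<dots> \<le> t' * norm W"
    using norm_meas_adj_le[OF R, of "l - l'"] l' by (intro mult_right_mono) (auto simp: dist_norm)
  finally have "norm (meas_adj A l' ** W) \<le> (t + t') * norm W"
    using W(3) by (simp add: distrib_right)
  then show ?thesis using W by (auto simp: near_singular_def)
qed

subsection \<open>Measurability\<close>

lemma continuous_on_matrix_mult [continuous_intros]:
  fixes A :: "'a::topological_space \<Rightarrow> real^'p^'n" and B :: "'a \<Rightarrow> real^'q^'p"
  assumes "continuous_on X A" "continuous_on X B"
  shows "continuous_on X (\<lambda>x. A x ** B x)"
  unfolding matrix_matrix_mult_def using assms by (intro continuous_intros)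

lemma continuous_on_matrix_vector_mult [continuous_intros]:
  fixes A :: "'a::topological_space \<Rightarrow> real^'p^'n" and v :: "'a \<Rightarrow> real^'p"
  assumes "continuous_on X A" "continuous_on X v"
  shows "continuous_on X (\<lambda>x. A x *v v x)"
  unfolding matrix_vector_mult_def using assms by (intro continuous_intros)

lemma continuous_on_transpose [continuous_intros]:
  fixes A :: "'a::topological_space \<Rightarrow> real^'p^'n"
  assumes "continuous_on X A"
  shows "continuous_on X (\<lambda>x. transpose (A x))"
  unfolding transpose_def using assms by (intro continuous_intros)

lemma continuous_on_meas_map [continuous_intros]:
  assumes "continuous_on X A" "continuous_on X B"
  shows "continuous_on X (\<lambda>x. meas_map (A x) (B x))"
  unfolding meas_map_def using assms by (intro continuous_intros)

lemma continuous_on_meas_adj [continuous_intros]: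
  assumes "continuous_on X A" "continuous_on X l"
  shows "continuous_on X (\<lambda>x. meas_adj (A x) (l x))"
  unfolding meas_adj_def using assms by (intro continuous_intros)

lemma continuous_on_slack [continuous_intros]:
  assumes "continuous_on X A" "continuous_on X B"
  shows "continuous_on X (\<lambda>x. slack (A x) b (B x))"
  unfolding slack_def using assms by (intro continuous_intros)

lemma closed_sym_tuples: "closed sym_tuples"
  unfolding span_sym_tuples_basis[symmetric] by (intro closed_subspace subspace_span)

text \<open>The existential quantifier over Y makes this a projection, and projections of Borel sets
  need not be Borel. Projections of compact sets are compact, so the set is exhausted by countably
  many of these.\<close>

lemma bad_tuples_borel:
  fixes b :: "real^'m"
  shows "(bad_tuples TYPE('p::finite) b R e0 e1 e2 :: ((real^'n^'n)^'m) set) \<in> sets borel"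
proof -
  \<comment> \<open>The two strict inequalities are tightened by 1 / (k + 1) to become closed
    conditions, and the norm of A is cut off at k; Y and the witness v of negative curvature are
    bounded already.\<close>
  define K where "K k = {z :: ((real^'n^'n)^'m) \<times> (real^'p^'n) \<times> (real^'n).
      (fst z \<in> sym_tuples \<and> norm (fst z) \<le> real k \<and> norm (fst (snd z)) \<le> R \<and> norm (snd (snd z)) = 1) \<and>
      (norm (slack (fst z) b (fst (snd z) ** transpose (fst (snd z))) ** fst (snd z)) \<le> e1 \<and>
      (\<forall>U :: real^'p^'n. norm U = 1 \<longrightarrow>
        - e2 \<le> slack (fst z) b (fst (snd z) ** transpose (fst (snd z))) \<bullet> (U ** transpose U)
          + 4 * (norm (meas_map (fst z) (U ** transpose (fst (snd z)))))\<^sup>2)) \<and>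
      e0 + 1 / real (Suc k) \<le> norm (meas_map (fst z) (fst (snd z) ** transpose (fst (snd z))) - b) \<and>
      snd (snd z) \<bullet> (slack (fst z) b (fst (snd z) ** transpose (fst (snd z))) *v snd (snd z)) \<le> - (5 * e2) - 1 / real (Suc k)}" for k
  have compact: "compact (K k)" for k
  proof -
    have "closed {z :: ((real^'n^'n)^'m) \<times> (real^'p^'n) \<times> (real^'n). fst z \<in> sym_tuples}"
      using continuous_closed_vimage[OF closed_sym_tuples, of fst] by (simp add: vimage_def)
    then have "closed (K k)"
      unfolding K_def
      by (intro closed_Collect_conj closed_Collect_all closed_Collect_imp open_Collect_const
          closed_Collect_le closed_Collect_eq continuous_intros)
    moreover have "K k \<subseteq> cball 0 (real k) \<times> cball 0 R \<times> cball 0 1"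
      by (auto simp: K_def)
    then have "bounded (K k)"
      by (rule bounded_subset[rotated]) (intro bounded_Times bounded_cball)
    ultimately show ?thesis by (simp add: compact_eq_bounded_closed)
  qed
  have "A \<in> bad_tuples TYPE('p) b R e0 e1 e2 \<longleftrightarrow> (\<exists>k. A \<in> fst ` K k)" for A :: "(real^'n^'n)^'m"
  proof
    assume "A \<in> bad_tuples TYPE('p) b R e0 e1 e2"
    then obtain Y :: "real^'p^'n" where A: "A \<in> sym_tuples" and "spurious_AC A b R e0 e1 e2 Y"
      by (auto simp: bad_tuples_def)
    note sp = this(2)[unfolded spurious_AC_iff[OF A]]
    then obtain v where v: "norm v = 1" "v \<bullet> (slack A b (Y ** transpose Y) *v v) < - (5 * e2)"
      by blast
    \<comment> \<open>The smaller of the two gaps in the strict inequalities; any k with 1 / (k + 1)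
      below it will do.\<close>
    define g where "g = min (norm (meas_map A (Y ** transpose Y) - b) - e0)
      (- (5 * e2) - v \<bullet> (slack A b (Y ** transpose Y) *v v))"
    have "g > 0" using sp v by (simp add: g_def)
    then obtain k1 where k1: "1 / real (Suc k1) < g" by (metis nat_approx_posE inverse_eq_divide)
    obtain k2 where k2: "norm A \<le> real k2" using real_arch_simple by blast
    define k where "k = max k1 k2"
    have "1 / real (Suc k) \<le> 1 / real (Suc k1)" by (simp add: k_def field_simps)
    then have "1 / real (Suc k) \<le> g" using k1 by simp
    moreover have "norm A \<le> real k" using k2 by (simp add: k_def)
    ultimately have "(A, Y, v) \<in> K k"
      using A sp v unfolding K_def g_def approx_2_critical_def by auto
    then show "\<exists>k. A \<in> fst ` K k" by force
  next
    assume "\<exists>k. A \<in> fst ` K k"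
    then obtain k Y v where K: "(A, Y, v) \<in> K k" by force
    have pos: "1 / real (Suc k) > 0" by simp
    from K have A: "A \<in> sym_tuples" by (simp add: K_def)
    have "spurious_AC A b R e0 e1 e2 Y"
      unfolding spurious_AC_iff[OF A] approx_2_critical_def
    proof (intro conjI exI[of _ v])
      show "e0 < norm (meas_map A (Y ** transpose Y) - b)"
        using K pos unfolding K_def mem_Collect_eq fst_conv snd_conv by linarith
      show "v \<bullet> (slack A b (Y ** transpose Y) *v v) < - (5 * e2)"
        using K pos unfolding K_def mem_Collect_eq fst_conv snd_conv by linarith
    qed (use K in \<open>auto simp: K_def\<close>)
    then show "A \<in> bad_tuples TYPE('p) b R e0 e1 e2" using A by (auto simp: bad_tuples_def)
  qed
  then have "bad_tuples TYPE('p) b R e0 e1 e2 = (\<Union>k. fst ` K k)"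
    by (intro set_eqI) (simp only: UN_iff bex_UNIV)
  moreover have "fst ` K k \<in> sets borel" for k
    by (intro borel_closed compact_imp_closed compact_continuous_image compact) (intro continuous_intros)
  ultimately show ?thesis by simp
qed

text \<open>The admissible \<open>W\<close> form a bounded set, so this is the projection of a
  compact set of pairs.\<close>

lemma compact_near_singular_Int_cball:
  fixes f :: "'p::finite \<Rightarrow> 'n::finite" and l :: "real^'m"
  shows "compact (near_singular l f t \<inter> cball c \<sigma>)"
proof -
  define K where "K = {z :: ((real^'n^'n)^'m) \<times> (real^'p^'n). dist c (fst z) \<le> \<sigma> \<and>
    (\<forall>i. snd z $ f i = axis i 1) \<and> (\<forall>a j. \<bar>snd z $ a $ j\<bar> \<le> 1) \<and>
    norm (meas_adj (fst z) l ** snd z) \<le> t * norm (snd z)}"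
  have "closed K"
    unfolding K_def
    by (intro closed_Collect_conj closed_Collect_all closed_Collect_le closed_Collect_eq continuous_intros)
  moreover have "bounded K"
  proof (rule bounded_subset)
    let ?q = "sqrt (real CARD('p) * (real CARD('n) - real CARD('p) + 1))"
    show "bounded (cball c \<sigma> \<times> (cball 0 ?q :: (real^'p^'n) set))"
      by (intro bounded_Times bounded_cball)
    have "norm W \<le> ?q" if "\<forall>i. W $ f i = axis i 1" "\<forall>a j. \<bar>W $ a $ j\<bar> \<le> 1" for W :: "real^'p^'n"
      using norm_bounded_row_coordinates[of W f] that by (intro real_le_rsqrt) auto
    then show "K \<subseteq> cball c \<sigma> \<times> cball 0 ?q" by (auto simp: K_def)
  qed
  ultimately have "compact (fst ` K)"
    by (intro compact_continuous_image) (auto simp: compact_eq_bounded_closed intro!: continuous_intros)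
  moreover have "fst ` K = near_singular l f t \<inter> cball c \<sigma>"
    by (auto simp: K_def near_singular_def image_iff) blast
  ultimately show ?thesis by simp
qed

subsection \<open>Slices in block directions\<close>

lemma tau_eq: "tau k = k + (k choose 2)"
  using binomial_Suc_Suc[of k 1] by (simp add: tau_def numeral_2_eq_2)

lemma orthonormal_sgn_sym_unit:
  "orthonormal (range (\<lambda>(i, j). sgn (sym_unit (f i) (f j))) :: (real^'n^'n) set)"
    (is "orthonormal (range ?g)") for f :: "'p::finite \<Rightarrow> 'n::finite"
proof -
  have "?g x \<bullet> ?g y = 0" if "?g x \<noteq> ?g y" for x y
  proof -
    obtain i j k l where xy: "x = (i, j)" "y = (k, l)" by (metis surj_pair)
    have "\<not> (f i = f k \<and> f j = f l)" "\<not> (f i = f l \<and> f j = f k)"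
      using that sym_unit_commute[of "f i" "f j"] by (auto simp: xy)
    then have "sym_unit (f i) (f j) \<bullet> sym_unit (f k) (f l) = 0"
      unfolding inner_sym_unit by auto
    then show ?thesis by (simp add: xy sgn_div_norm)
  qed
  then show ?thesis
    by (auto simp: orthonormal_def pairwise_def orthogonal_def norm_sgn sym_unit_nonzero)
qed

text \<open>A unit is determined by its set of nonzero rows, which is {f i, f j}. So the units are
  counted by the one- and two-element subsets of the range of \<open>f\<close>, the diagonal and
  off-diagonal cases.\<close>

lemma card_sgn_sym_unit:
  fixes f :: "'p::finite \<Rightarrow> 'n::finite"
  assumes f: "inj f"
  shows "card (range (\<lambda>(i, j). sgn (sym_unit (f i) (f j))) :: (real^'n^'n) set) = tau CARD('p)"
proof -
  let ?g = "\<lambda>(i, j). sgn (sym_unit (f i) (f j)) :: real^'n^'n"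
  define supp where "supp X = {a. \<exists>c. X $ a $ c \<noteq> 0}" for X :: "real^'n^'n"
  have supp: "supp (?g (i, j)) = {f i, f j}" for i j
    using sym_unit_nonzero[of "f i" "f j"]
    by (auto simp: supp_def sgn_div_norm sym_unit_nth)
  have inj: "inj_on supp (range ?g)"
  proof (rule inj_onI)
    fix X Z assume "X \<in> range ?g" "Z \<in> range ?g" and eq: "supp X = supp Z"
    then obtain i j k l where XZ: "X = ?g (i, j)" "Z = ?g (k, l)" by fast
    then have "(f i = f k \<and> f j = f l) \<or> (f i = f l \<and> f j = f k)"
      using eq unfolding XZ supp by (simp add: doubleton_eq_iff)
    then show "X = Z" using sym_unit_commute[of "f i" "f j"] by (auto simp: XZ)
  qed
  have "supp ` range ?g = {S. S \<subseteq> range f \<and> card S = 1} \<union> {S. S \<subseteq> range f \<and> card S = 2}"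
    (is "_ = ?R")
  proof
    show "supp ` range ?g \<subseteq> ?R"
    proof
      fix S assume "S \<in> supp ` range ?g"
      then obtain i j where "S = {f i, f j}" using supp by fastforce
      then show "S \<in> ?R" by (cases "f i = f j") auto
    qed
    show "?R \<subseteq> supp ` range ?g"
    proof
      fix S assume S: "S \<in> ?R"
      have "\<exists>i j. S = {f i, f j}"
        using S by (auto simp: card_1_singleton_iff card_2_iff) blast
      then obtain i j where "S = supp (?g (i, j))" using supp by metis
      then show "S \<in> supp ` range ?g" by blast
    qed
  qed
  then have "card (range ?g) = card ?R"
    using card_image[OF inj] by simp
  also have "\<dots> = card {S. S \<subseteq> range f \<and> card S = 1} + card {S. S \<subseteq> range f \<and> card S = 2}"
    by (intro card_Un_disjoint) auto
  also have "\<dots> = tau CARD('p)"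
    using f by (simp add: n_subsets card_image tau_eq)
  finally show ?thesis .
qed

text \<open>For a unit vector \<open>u\<close> the map from D to u (x) D is a linear isometry, so it
  carries an orthonormal basis of the symmetric matrices supported on the block to the required
  set.\<close>

lemma block_direction_basis:
  fixes f :: "'p::finite \<Rightarrow> 'n::finite" and u :: "real^'m"
  assumes u: "norm u = 1" and f: "inj f"
  obtains C :: "((real^'n^'n)^'m) set" where
    "orthonormal C" "card C = tau CARD('p)" "C \<subseteq> sym_tuples"
    "\<And>x. x \<in> span C \<Longrightarrow> \<exists>D. x = (\<chi> k. u $ k *\<^sub>R D) \<and>
        (\<forall>a c. a \<notin> range f \<or> c \<notin> range f \<longrightarrow> D $ a $ c = 0)"
proof -
  define E :: "(real^'n^'n) set" where "E = range (\<lambda>(i, j). sgn (sym_unit (f i) (f j)))"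
  define \<phi> :: "real^'n^'n \<Rightarrow> (real^'n^'n)^'m" where "\<phi> D = (\<chi> k. u $ k *\<^sub>R D)" for D
  have lin: "linear \<phi>"
    by (auto intro!: linearI simp: \<phi>_def vec_eq_iff scaleR_add_right)
  have iso: "\<phi> X \<bullet> \<phi> Z = X \<bullet> Z" for X Z
  proof -
    have "\<phi> X \<bullet> \<phi> Z = (u \<bullet> u) * (X \<bullet> Z)"
      by (subst inner_vec_def) (simp add: \<phi>_def inner_vec_def[of u] sum_distrib_left mult_ac)
    then show ?thesis using u by (simp add: norm_eq_1)
  qed
  have nrm: "norm (\<phi> X) = norm X" for X by (simp add: norm_eq_sqrt_inner iso)
  have "X = Z" if "\<phi> X = \<phi> Z" for X Z
    using nrm[of "X - Z"] that by (simp add: linear_diff[OF lin])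
  then have inj: "inj_on \<phi> E" by (auto intro: inj_onI)
  have orthE: "orthonormal E" unfolding E_def by (rule orthonormal_sgn_sym_unit)
  show thesis
  proof (rule that[of "\<phi> ` E"])
    show "orthonormal (\<phi> ` E)"
      using orthE by (auto simp: orthonormal_def pairwise_def orthogonal_def iso nrm)
    show "card (\<phi> ` E) = tau CARD('p)"
      using card_image[OF inj] card_sgn_sym_unit[OF f] by (simp add: E_def)
    have "sym_unit i j $ c $ a = sym_unit i j $ a $ c" for i j a c :: 'n
      by (simp only: sym_unit_nth add.commute)
    then show "\<phi> ` E \<subseteq> sym_tuples"
      by (auto simp: E_def \<phi>_def sym_tuples_def sym_mats_def transpose_def vec_eq_iff sgn_div_norm)
    fix x assume "x \<in> span (\<phi> ` E)"
    then obtain D where D: "D \<in> span E" "x = \<phi> D"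
      using linear_span_image[OF lin, of E] by auto
    have "subspace {D :: real^'n^'n. \<forall>a c. a \<notin> range f \<or> c \<notin> range f \<longrightarrow> D $ a $ c = 0}"
      by (auto simp: subspace_def)
    moreover have "E \<subseteq> {D. \<forall>a c. a \<notin> range f \<or> c \<notin> range f \<longrightarrow> D $ a $ c = 0}"
      by (auto simp: E_def sgn_div_norm sym_unit_nth)
    ultimately have "D \<in> {D. \<forall>a c. a \<notin> range f \<or> c \<notin> range f \<longrightarrow> D $ a $ c = 0}"
      using D(1) span_minimal by blast
    then show "\<exists>D. x = (\<chi> k. u $ k *\<^sub>R D) \<and>
        (\<forall>a c. a \<notin> range f \<or> c \<notin> range f \<longrightarrow> D $ a $ c = 0)"
      using D(2) by (auto simp: \<phi>_def)
  qed
qed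

lemma orthonormal_sym_tuples_basis: "orthonormal sym_tuples_basis"
  by (simp add: orthonormal_def finite_sym_tuples_basis orthogonal_sym_tuples_basis norm_sym_tuples_basis)

lemma lborel_sym_tuples_eq: "lborel_sym_tuples = span_lborel sym_tuples_basis"
  by (simp add: lborel_sym_tuples_def span_lborel_def)

text \<open>A perfect square is used as the bound so that \<open>sqrt N\<close> in the slice
  estimate becomes nm.\<close>

lemma card_sym_tuples_basis_le:
  "card (sym_tuples_basis :: ((real^'n^'n)^'m) set) \<le> (CARD('n) * CARD('m))\<^sup>2"
proof -
  have "sym_tuples_basis = range (\<lambda>(k, i, j). axis k (sgn (sym_unit i j)) :: (real^'n^'n)^'m)"
    unfolding sym_tuples_basis_def by (auto simp: image_def)
  then have "card (sym_tuples_basis :: ((real^'n^'n)^'m) set) \<le> CARD('m \<times> 'n \<times> 'n)"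
    by (metis card_image_le finite)
  also have "\<dots> = CARD('m) * (CARD('n) * CARD('n))" by simp
  also have "\<dots> \<le> (CARD('m) * CARD('m)) * (CARD('n) * CARD('n))"
    by (intro mult_right_mono) auto
  finally show ?thesis by (simp add: power2_eq_square mult_ac)
qed

lemma measure_near_singular_le:
  fixes f :: "'p::finite \<Rightarrow> 'n::finite" and l :: "real^'m"
  assumes l: "2 * e0 \<le> norm l" and e0: "e0 > 0" and t: "t > 0" and c: "c \<in> sym_tuples"
    and \<sigma>: "\<sigma> > 0" and f: "inj f"
  defines "q \<equiv> real CARD('p) * (real CARD('n) - real CARD('p) + 1)"
  shows "measure lborel_sym_tuples (near_singular l f (2 * t) \<inter> cball c \<sigma> \<inter> sym_tuples)
    \<le> 2 * exp (1/2) * (2 * t * q / e0 * (real CARD('n) * real CARD('m)) / \<sigma>) ^ tau CARD('p)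
       * measure lborel_sym_tuples (cball c \<sigma>)"
proof -
  let ?X = "near_singular l f (2 * t) \<inter> cball c \<sigma> \<inter> sym_tuples"
  have l0: "norm l > 0" using l e0 by linarith
  define u where "u = (1 / norm l) *\<^sub>R l"
  have u: "norm u = 1" using l0 by (simp add: u_def)
  obtain C :: "((real^'n^'n)^'m) set" where C: "orthonormal C" "card C = tau CARD('p)" "C \<subseteq> sym_tuples"
    and spC: "\<And>x. x \<in> span C \<Longrightarrow> \<exists>D. x = (\<chi> k. u $ k *\<^sub>R D) \<and>
        (\<forall>a c. a \<notin> range f \<or> c \<notin> range f \<longrightarrow> D $ a $ c = 0)"
    using block_direction_basis[OF u f] by metis
  have "CARD('p) \<le> CARD('n)" using card_inj_on_le[OF f] by simp
  then have q: "q > 0" unfolding q_def by (intro mult_pos_pos) auto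
  have slice: "norm (x - y) \<le> 2 * t * q / e0" if x: "x \<in> ?X" and y: "y \<in> ?X" and d: "x - y \<in> span C" for x y
  proof -
    obtain D where D: "x - y = (\<chi> k. u $ k *\<^sub>R D)" "\<And>a c. a \<notin> range f \<or> c \<notin> range f \<Longrightarrow> D $ a $ c = 0"
      using spC[OF d] by blast
    obtain W where W: "\<And>i. W $ f i = axis i 1" "\<And>a j. \<bar>W $ a $ j\<bar> \<le> 1"
        "norm (meas_adj y l ** W) \<le> 2 * t * norm W"
      using y by (auto simp: near_singular_def)
    obtain W' where W': "\<And>i. W' $ f i = axis i 1" "\<And>a j. \<bar>W' $ a $ j\<bar> \<le> 1"
        "norm (meas_adj x l ** W') \<le> 2 * t * norm W'"
      using x by (auto simp: near_singular_def)
    have w: "norm W \<le> sqrt q" "norm W' \<le> sqrt q"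
      using norm_bounded_row_coordinates[OF W(1,2)] norm_bounded_row_coordinates[OF W'(1,2)]
      by (auto simp: q_def intro: real_le_rsqrt)
    \<comment> \<open>Since \<open>u\<close> is \<open>l\<close> normalised, moving the tuple by u
      (x) D moves \<open>meas_adj\<close> by |l| D: among unit vectors this is the direction with
      the largest effect.\<close>
    have "(\<Sum>k\<in>UNIV. l $ k * u $ k) = norm l"
    proof -
      have "(\<Sum>k\<in>UNIV. l $ k * u $ k) = (l \<bullet> l) / norm l"
        by (simp add: u_def inner_vec_def sum_divide_distrib)
      then show ?thesis using l0 by (simp add: power2_norm_eq_inner[symmetric] power2_eq_square)
    qed
    moreover have "meas_adj x l - meas_adj y l = meas_adj (x - y) l"
      by (simp add: meas_adj_def scaleR_diff_right sum_subtractf)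
    moreover have "meas_adj (x - y) l = (\<Sum>k\<in>UNIV. l $ k * u $ k) *\<^sub>R D"
      by (simp add: meas_adj_def D(1) scaleR_sum_left)
    ultimately have adj: "meas_adj x l - meas_adj y l = norm l *\<^sub>R D" by simp
    \<comment> \<open>Block comparison with a = 2 t sqrt q and w = sqrt q, where q bounds the
      squares of |W| and |W'|.\<close>
    have "norm (meas_adj x l - meas_adj y l) \<le> 2 * (2 * t * sqrt q) * sqrt q"
    proof (rule norm_block_difference_le[OF W(1) W'(1) w])
      show "norm (meas_adj y l ** W) \<le> 2 * t * sqrt q" "norm (meas_adj x l ** W') \<le> 2 * t * sqrt q"
        using W(3) W'(3) w t by (auto intro: order_trans mult_left_mono)
      show "meas_adj x l \<in> sym_mats" using x by (intro meas_adj_sym) auto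
      show "(meas_adj x l - meas_adj y l) $ a $ b = 0" if "a \<notin> range f \<or> b \<notin> range f" for a b
        using D(2)[OF that] by (simp add: adj)
    qed
    also have "\<dots> = 4 * t * q" using q by simp
    finally have "norm l * norm D \<le> 4 * t * q" by (simp add: adj)
    moreover have "2 * e0 * norm D \<le> norm l * norm D" using l by (intro mult_right_mono) auto
    ultimately have "norm D \<le> 2 * t * q / e0" using e0 by (simp add: field_simps)
    moreover have "norm (x - y) = norm D"
    proof -
      have "(norm (x - y))\<^sup>2 = (\<Sum>k\<in>UNIV. (u $ k)\<^sup>2 * (norm D)\<^sup>2)"
        unfolding D(1) by (subst norm_vec_power2) (simp add: power_mult_distrib)
      also have "\<dots> = (norm u)\<^sup>2 * (norm D)\<^sup>2" by (simp add: norm_vec_power2[of u] sum_distrib_right)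
      finally show ?thesis using u by simp
    qed
    ultimately show ?thesis by simp
  qed
  have "measure (span_lborel sym_tuples_basis) ?X
      \<le> 2 * exp (1/2) * (2 * t * q / e0 * sqrt (real ((CARD('n) * CARD('m))\<^sup>2)) / \<sigma>) ^ card C
        * measure (span_lborel sym_tuples_basis) (cball c \<sigma>)"
  proof (rule measure_le_by_slices[OF orthonormal_sym_tuples_basis C(1)])
    show "C \<subseteq> span sym_tuples_basis" "c \<in> span sym_tuples_basis"
      using C(3) c by (simp_all add: span_sym_tuples_basis)
    show "?X \<in> sets borel"
      by (intro borel_closed closed_Int[OF compact_imp_closed closed_sym_tuples]
          compact_near_singular_Int_cball)
    show "2 * t * q / e0 > 0" using t q e0 by simp
    show "card (sym_tuples_basis :: ((real^'n^'n)^'m) set) \<le> (CARD('n) * CARD('m))\<^sup>2"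
      by (rule card_sym_tuples_basis_le)
  qed (use \<sigma> slice in auto)
  then show ?thesis by (simp add: lborel_sym_tuples_eq C(2))
qed

subsection \<open>Covering the bad tuples\<close>

text \<open>At p = 4 the value is 500/512, and each later step multiplies it by at most (5/4)(5/8) =
  25/32.\<close>

lemma mult_five_eighths_power_le: "p \<ge> 4 \<Longrightarrow> real p * (5/8) ^ (p - 1) \<le> 1"
proof (induction p rule: nat_induct_at_least)
  case base
  show ?case by (simp add: power_numeral_reduce)
next
  case (Suc p)
  have "real (Suc p) * (5/8) ^ (Suc p - 1) = (real (Suc p) * (5/8)) * (5/8) ^ (p - 1)"
    using Suc.hyps by (cases p) simp_all
  also have "\<dots> \<le> real p * (5/8) ^ (p - 1)"
    using Suc.hyps by (intro mult_right_mono) auto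
  finally show ?case using Suc.IH by simp
qed

text \<open>The number \<open>n ^ p\<close> of choices of the block is absorbed by the gain of
  \<open>p (n - p + 1) \<le> n\<^sup>2\<close> in the slice diameter.\<close>

lemma index_choices_le:
  fixes n p :: nat
  assumes p: "2 \<le> p" and pn: "p \<le> n"
  shows "real n ^ p * (real p * (real n - real p + 1) / (real n)\<^sup>2) ^ tau p \<le> 2 * exp (1/2)"
proof -
  define x where "x = real p * (real n - real p + 1) / (real n)\<^sup>2"
  define y where "y = (real p + 1) / (2 * real p)"
  have n: "real n > 0" and p0: "real p > 0" using p pn by auto
  have x0: "x \<ge> 0" unfolding x_def using pn by (intro divide_nonneg_nonneg mult_nonneg_nonneg) auto
  have y0: "y \<ge> 0" by (simp add: y_def)
  \<comment> \<open>Since tau p = p + (p choose 2), p of the factors x cancel n^p and leave p^p; the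
    remaining p (p - 1) / 2 factors must beat p^p.\<close>
  have "real p * (real n - real p + 1) \<le> real p * real n"
    using p by (intro mult_left_mono) auto
  then have x1: "real n * x \<le> real p"
    using n by (simp add: x_def power2_eq_square field_simps)
  \<comment> \<open>By the arithmetic-geometric mean inequality x <= ((n + 1) / (2n))^2. The right
    side decreases in n, so p <= n allows n to be replaced by p, which gives y^2.\<close>
  have "0 \<le> (real p - (real n - real p + 1))\<^sup>2" by simp
  then have "4 * (real p * (real n - real p + 1)) \<le> (real n + 1)\<^sup>2"
    by (simp add: power2_eq_square algebra_simps)
  then have "4 * (real p * (real n - real p + 1)) / (2 * real n)\<^sup>2 \<le> (real n + 1)\<^sup>2 / (2 * real n)\<^sup>2"
    by (intro divide_right_mono) auto
  then have "x \<le> ((real n + 1) / (2 * real n))\<^sup>2"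
    by (simp add: x_def power_divide power_mult_distrib)
  also have "\<dots> \<le> y\<^sup>2"
    using n p0 pn unfolding y_def by (intro power_mono) (auto simp: field_simps)
  finally have x2: "x \<le> y\<^sup>2" .
  have "even (p * (p - 1))" by (cases "even p") auto
  then have "2 * (p choose 2) = p * (p - 1)"
    by (simp add: choose_two)
  then have y2: "(y\<^sup>2) ^ (p choose 2) = (y ^ (p - 1)) ^ p"
    by (simp add: power_mult[symmetric] mult.commute)
  have "real n ^ p * x ^ tau p = (real n * x) ^ p * x ^ (p choose 2)"
    by (simp add: tau_eq power_add power_mult_distrib)
  also have "\<dots> \<le> real p ^ p * (y\<^sup>2) ^ (p choose 2)"
    using x0 x1 x2 n by (intro mult_mono power_mono) auto
  also have "\<dots> = (real p * y ^ (p - 1)) ^ p"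
    unfolding y2 by (simp add: power_mult_distrib)
  also have "\<dots> \<le> 3"
  proof -
    \<comment> \<open>For p = 2 and p = 3 the values are 9/4 and 64/27. From p = 4 on, y <= 5/8 and
      the base is at most 1.\<close>
    consider "p = 2" | "p = 3" | "p \<ge> 4" using p by linarith
    then show ?thesis
    proof cases
      case 3
      have "y \<le> 5/8" using 3 p0 by (simp add: y_def field_simps)
      then have "real p * y ^ (p - 1) \<le> real p * (5/8) ^ (p - 1)"
        using y0 by (intro mult_left_mono power_mono) auto
      also have "\<dots> \<le> 1" by (rule mult_five_eighths_power_le[OF 3])
      finally have "(real p * y ^ (p - 1)) ^ p \<le> 1"
        using y0 by (intro power_le_one) auto
      then show ?thesis by simp
    qed (simp_all add: y_def power_numeral_reduce)
  qed
  also have "3 \<le> 2 * exp (1/2 :: real)"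
    using exp_ge_add_one_self[of "1/2 :: real"] by simp
  finally show ?thesis by (simp add: x_def)
qed

text \<open>The parameter \<open>d\<close> serves both as a tolerance above \<delta> and, divided by
  R_A, as the mesh of the net; it is positive even when \<delta> vanishes.\<close>

lemma measure_bad_tuples_le:
  fixes b :: "real^'m" and Abar :: "(real^'n^'n)^'m" and R_Y e0 e1 e2 \<sigma> R_A d \<kappa> :: real
  defines "R_A \<equiv> onorm (meas_map Abar) + \<sigma>"
    and "\<kappa> \<equiv> 2 * (R_A * R_Y\<^sup>2 + norm b) * R_A"
  assumes tau: "tau CARD('p::finite) > CARD('m)"
    and e0: "e0 > 0" and e2: "e2 > 0"
    and Abar: "Abar \<in> sym_tuples" and \<sigma>: "\<sigma> > 0"
    and d: "e1 * R_A / sqrt e2 \<le> d" "d > 0" "d < \<sigma> * e0 / (4 * real CARD('n) ^ 3 * real CARD('m))"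
  shows "measure lborel_sym_tuples (cball Abar \<sigma> \<inter> bad_tuples TYPE('p) b R_Y e0 e1 e2)
    \<le> 4 * exp 1 * d ^ (tau CARD('p) - CARD('m)) * (3 * \<kappa>) ^ CARD('m)
          * (2 * real CARD('n) ^ 3 * real CARD('m) / (\<sigma> * e0)) ^ tau CARD('p)
          * measure lborel_sym_tuples (cball Abar \<sigma>)"
proof -
  let ?bad = "cball Abar \<sigma> \<inter> bad_tuples TYPE('p) b R_Y e0 e1 e2"
  let ?\<nu> = "lborel_sym_tuples :: ((real^'n^'n)^'m) measure"
  define n where "n = real CARD('n)"
  define m where "m = real CARD('m)"
  define p where "p = CARD('p)"
  define V where "V = measure ?\<nu> (cball Abar \<sigma>)"
  have n: "n \<ge> 1" and m: "m \<ge> 1" by (simp_all add: n_def m_def Suc_le_eq)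
  \<comment> \<open>tau 1 = 1 cannot exceed m, and the count of index choices starts at p =
    2.\<close>
  have "\<not> p < 2"
  proof
    assume "p < 2"
    then have "tau p \<le> 1" by (cases "p = 0") (auto simp: tau_eq numeral_2_eq_2 less_Suc_eq)
    moreover have "CARD('m) \<ge> 1" by (simp add: Suc_le_eq)
    ultimately show False using tau by (simp add: p_def)
  qed
  then have p2: "p \<ge> 2" by simp
  have RA: "R_A > 0"
    using onorm_pos_le[OF bounded_linear_meas_map[of Abar]] \<sigma> by (simp add: R_A_def)
  have R_A_bound: "norm (meas_map A X) \<le> R_A * norm X" if "A \<in> cball Abar \<sigma>" for A X
    using norm_meas_map_cball_le[OF that] by (simp add: R_A_def)
  define \<Lambda> where "\<Lambda> = 2 * (R_A * R_Y\<^sup>2 + norm b)"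
  have \<Lambda>: "\<Lambda> \<ge> 0" using RA by (simp add: \<Lambda>_def)
  have \<kappa>: "\<kappa> = \<Lambda> * R_A" by (simp add: \<kappa>_def \<Lambda>_def)
  have \<kappa>0: "\<kappa> \<ge> 0" using \<Lambda> RA by (simp add: \<kappa>)
  define s where "s = d / R_A"
  have s: "s > 0" using d(2) RA by (simp add: s_def)
  \<comment> \<open>The net is taken inside this shell, so its points inherit |l| >= 2 e0, on which
    the slice diameter depends.\<close>
  define K :: "(real^'m) set" where "K = {l. 2 * e0 \<le> norm l \<and> norm l \<le> \<Lambda>}"
  have "closed K" unfolding K_def
    by (intro closed_Collect_conj closed_Collect_le continuous_intros)
  moreover have K\<Lambda>: "K \<subseteq> cball 0 \<Lambda>" by (auto simp: K_def)
  ultimately have "compact K"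
    using bounded_subset bounded_cball compact_eq_bounded_closed by blast
  then obtain Z where Z: "finite Z" "Z \<subseteq> K" "pairwise (\<lambda>x y. dist x y > s) Z" "K \<subseteq> (\<Union>z\<in>Z. cball z s)"
    using separated_net_exists s by blast
  \<comment> \<open>Absorbing the 1 in 1 + 2 \<kappa> / d needs d <= \<kappa>. If the shell is
    nonempty then 2 e0 R_A <= \<kappa>, and the smallness of \<open>d\<close> gives d <= \<sigma> e0
    <= R_A e0.\<close>
  have cardZ: "real (card Z) \<le> (3 * \<kappa> / d) ^ CARD('m)"
  proof (cases "Z = {}")
    case True
    then show ?thesis using \<kappa>0 d(2) by simp
  next
    case False
    then obtain l where "l \<in> K" using Z(2) by blast
    then have "2 * e0 \<le> \<Lambda>" by (auto simp: K_def)
    then have "2 * e0 * R_A \<le> \<kappa>" using RA by (simp add: \<kappa>)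
    moreover have "d \<le> \<sigma> * e0"
    proof -
      have "1 \<le> 4 * n ^ 3 * m"
        using n m by (intro mult_ge1_I) (auto intro: one_le_power)
      then have "\<sigma> * e0 / (4 * n ^ 3 * m) \<le> \<sigma> * e0 / 1"
        using \<sigma> e0 n m by (intro divide_left_mono mult_pos_pos) auto
      then show ?thesis using d(3) by (simp add: n_def m_def)
    qed
    moreover have "\<sigma> * e0 \<le> R_A * e0"
      using onorm_pos_le[OF bounded_linear_meas_map[of Abar]] e0 by (intro mult_right_mono) (auto simp: R_A_def)
    moreover have "0 < R_A * e0" using RA e0 by simp
    ultimately have d\<kappa>: "d \<le> \<kappa>" by (simp add: mult_ac)
    have "real (card Z) \<le> (1 + 2 * \<Lambda> / s) ^ CARD('m)"
      using card_separated_le[OF Z(1) _ Z(3) s \<Lambda>] Z(2) K\<Lambda> by (auto simp: subset_trans)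
    also have "1 + 2 * \<Lambda> / s = 1 + 2 * \<kappa> / d" using RA by (simp add: s_def \<kappa>)
    also have "(1 + 2 * \<kappa> / d) ^ CARD('m) \<le> (3 * \<kappa> / d) ^ CARD('m)"
      using d\<kappa> d(2) \<kappa>0 by (intro power_mono) (auto simp: field_simps)
    finally show ?thesis .
  qed
  define q where "q = real p * (n - real p + 1)"
  define F where "F = {f :: 'p \<Rightarrow> 'n. inj f}"
  have cardF: "real (card F) \<le> n ^ p"
  proof -
    have "card F \<le> card (UNIV :: ('p \<Rightarrow> 'n) set)" by (intro card_mono) auto
    also have "\<dots> = CARD('n) ^ CARD('p)" by (simp add: card_fun)
    finally show ?thesis
      unfolding n_def p_def by (metis of_nat_le_iff of_nat_power)
  qed
  define X where "X l f = near_singular l f (2 * d) \<inter> cball Abar \<sigma> \<inter> sym_tuples" for l :: "real^'m" and f :: "'p \<Rightarrow> 'n"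
  have Xm: "X l f \<in> sets borel" for l f
    unfolding X_def by (intro borel_closed closed_Int[OF compact_imp_closed closed_sym_tuples]
          compact_near_singular_Int_cball)
  have cover: "?bad \<subseteq> (\<Union>l\<in>Z. \<Union>f\<in>F. X l f)"
  proof
    fix A assume A: "A \<in> ?bad"
    then obtain Y :: "real^'p^'n" where Y: "spurious_AC A b R_Y e0 e1 e2 Y"
      and sym: "A \<in> sym_tuples" and cb: "A \<in> cball Abar \<sigma>"
      by (auto simp: bad_tuples_def)
    obtain l and f :: "'p \<Rightarrow> 'n" where l: "2 * e0 < norm l" "norm l \<le> 2 * (R_A * R_Y\<^sup>2 + norm b)"
      and A1: "A \<in> near_singular l f (e1 * R_A / sqrt e2)"
      using spurious_AC_imp_near_singular[OF Y sym e2 RA R_A_bound[OF cb]] by blast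
    have f: "f \<in> F" using A1 inj_if_axis_rows by (auto simp: near_singular_def F_def)
    have "l \<in> K" using l by (simp add: K_def \<Lambda>_def)
    then obtain z where z: "z \<in> Z" "dist z l \<le> s" using Z(4) by auto
    have "A \<in> near_singular l f d"
      using A1 near_singular_mono[OF d(1)] by blast
    \<comment> \<open>Rounding l to z costs R_A times the mesh s = d / R_A, that is, another
      d.\<close>
    then have "A \<in> near_singular z f (d + d)"
      using z RA by (intro near_singular_perturb[OF _ R_A_bound[OF cb]])
        (auto simp: s_def dist_commute field_simps)
    then show "A \<in> (\<Union>l\<in>Z. \<Union>f\<in>F. X l f)"
      using z(1) f sym cb by (auto simp: X_def)
  qed
  have fm: "cball Abar \<sigma> \<in> fmeasurable ?\<nu>"
    using measure_cball_span_lborel(1)[OF orthonormal_sym_tuples_basis, of Abar \<sigma>] Abar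
    by (simp add: fmeasurable_def lborel_sym_tuples_eq span_sym_tuples_basis)
  have sets: "sets ?\<nu> = sets borel" by (simp add: lborel_sym_tuples_eq)
  have fmX: "X l f \<in> fmeasurable ?\<nu>" for l f
    by (rule fmeasurableI2[OF fm]) (use Xm[of l f] in \<open>auto simp: X_def sets\<close>)
  have "?bad \<in> sets borel"
    by (intro sets.Int borel_closed closed_cball bad_tuples_borel)
  then have bad: "?bad \<in> sets ?\<nu>" by (simp only: sets)
  define \<beta> where "\<beta> = 2 * exp (1/2) * (2 * d * q / e0 * (n * m) / \<sigma>) ^ tau p * V"
  have "measure ?\<nu> ?bad \<le> measure ?\<nu> (\<Union>l\<in>Z. \<Union>f\<in>F. X l f)"
    by (intro measure_mono_fmeasurable[OF cover bad] fmeasurable.finite_UN Z(1) fmX) simp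
  also have "\<dots> \<le> (\<Sum>l\<in>Z. measure ?\<nu> (\<Union>f\<in>F. X l f))"
    using Z(1) fmX by (intro measure_UNION_le) (auto simp: fmeasurable_def)
  also have "\<dots> \<le> (\<Sum>l\<in>Z. \<Sum>f\<in>F. measure ?\<nu> (X l f))"
    using fmX by (intro sum_mono measure_UNION_le) (auto simp: fmeasurable_def)
  also have "\<dots> \<le> (\<Sum>l\<in>Z. \<Sum>f\<in>F. \<beta>)"
  proof (intro sum_mono)
    fix l f assume "l \<in> Z" "f \<in> F"
    then have "2 * e0 \<le> norm l" "inj f" using Z(2) by (auto simp: K_def F_def)
    from measure_near_singular_le[OF this(1) e0 d(2) Abar \<sigma> this(2)]
    show "measure ?\<nu> (X l f) \<le> \<beta>"
      by (simp add: X_def \<beta>_def q_def n_def m_def p_def V_def)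
  qed
  also have "\<dots> = real (card Z) * real (card F) * \<beta>" by simp
  finally have main: "measure ?\<nu> ?bad \<le> real (card Z) * real (card F) * \<beta>" .
  show ?thesis
  proof (cases "F = {}")
    \<comment> \<open>This happens when p > n: the union covering the bad tuples is then
      empty.\<close>
    case True
    then have "measure ?\<nu> ?bad \<le> 0" using main by simp
    also have "0 \<le> 4 * exp 1 * d ^ (tau CARD('p) - CARD('m)) * (3 * \<kappa>) ^ CARD('m)
          * (2 * real CARD('n) ^ 3 * real CARD('m) / (\<sigma> * e0)) ^ tau CARD('p)
          * measure ?\<nu> (cball Abar \<sigma>)"
      using d(2) \<kappa>0 \<sigma> e0 by (intro mult_nonneg_nonneg) auto
    finally show ?thesis .
  next
    case False
    then obtain f :: "'p \<Rightarrow> 'n" where "inj f" by (auto simp: F_def)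
    then have pn: "p \<le> CARD('n)" using card_inj_on_le[of f UNIV UNIV] by (simp add: p_def)
    have q: "q \<ge> 0" unfolding q_def n_def using pn by (intro mult_nonneg_nonneg) auto
    define B where "B = 2 * n ^ 3 * m / (\<sigma> * e0)"
    have B: "B \<ge> 0" using n m \<sigma> e0 by (simp add: B_def)
    have V: "V \<ge> 0" by (simp add: V_def)
    \<comment> \<open>Splitting off q / n^2 isolates the factor that pays for the choices of
      \<open>f\<close>; what remains is d times the base in the theorem.\<close>
    have "2 * d * q / e0 * (n * m) / \<sigma> = d * (q / n\<^sup>2) * B"
      using n e0 \<sigma> by (simp add: B_def power2_eq_square power3_eq_cube) (simp add: mult_ac)
    then have \<beta>: "\<beta> = 2 * exp (1/2) * (d ^ tau p * (q / n\<^sup>2) ^ tau p * B ^ tau p) * V"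
      by (simp only: \<beta>_def power_mult_distrib)
    then have \<beta>0: "\<beta> \<ge> 0" using d(2) q B V by simp
    have "real (card Z) * real (card F) * \<beta> \<le> (3 * \<kappa> / d) ^ CARD('m) * n ^ p * \<beta>"
      using cardZ cardF \<beta>0 \<kappa>0 d(2) by (intro mult_mono) auto
    also have "\<dots> = (n ^ p * (q / n\<^sup>2) ^ tau p) * (2 * exp (1/2) * ((3 * \<kappa> / d) ^ CARD('m) * d ^ tau p) * B ^ tau p * V)"
      by (simp add: \<beta> mult_ac)
    also have "\<dots> \<le> (2 * exp (1/2)) * (2 * exp (1/2) * ((3 * \<kappa> / d) ^ CARD('m) * d ^ tau p) * B ^ tau p * V)"
      using index_choices_le[OF p2 pn] d(2) \<kappa>0 B V
      by (intro mult_right_mono) (auto simp: q_def n_def)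
    also have "(3 * \<kappa> / d) ^ CARD('m) * d ^ tau p = (3 * \<kappa>) ^ CARD('m) * d ^ (tau p - CARD('m))"
      using tau d(2) by (simp add: power_divide power_diff p_def)
    also have "(2 * exp (1/2)) * (2 * exp (1/2) * ((3 * \<kappa>) ^ CARD('m) * d ^ (tau p - CARD('m))) * B ^ tau p * V)
        = 4 * (exp (1/2) * exp (1/2)) * d ^ (tau p - CARD('m)) * (3 * \<kappa>) ^ CARD('m) * B ^ tau p * V"
      by (simp add: mult_ac)
    also have "exp (1/2) * exp (1/2) = exp (1 :: real)" by (simp add: exp_add[symmetric])
    finally show ?thesis using main by (simp add: B_def p_def n_def m_def V_def)
  qed
qed

theorem theorem4p5:
  fixes b :: "real^'m"
    and Abar :: "(real^'n^'n)^'m"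
    and R_Y e0 e1 e2 \<sigma> R_A \<delta> \<kappa> :: real
    and M :: "'w measure"
    and A :: "'w \<Rightarrow> (real^'n^'n)^'m"
  defines "R_A \<equiv> onorm (meas_map Abar) + \<sigma>"
    and "\<delta> \<equiv> e1 * R_A / sqrt e2"
    and "\<kappa> \<equiv> 2 * (R_A * R_Y\<^sup>2 + norm b) * R_A"
  assumes "tau CARD('p::finite) > CARD('m)"
    and "R_Y \<ge> 0" and "e0 > 0" and "e1 \<ge> 0" and "e2 > 0"
    and "Abar \<in> sym_tuples" and "\<sigma> > 0"
    and "prob_space M" and "A \<in> borel_measurable M"
    and "distr M borel A = uniform_measure lborel_sym_tuples (cball Abar \<sigma> \<inter> sym_tuples)"
    and "\<delta> < \<sigma> * e0 / (4 * real CARD('n) ^ 3 * real CARD('m))"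
  shows "{\<omega> \<in> space M. A \<omega> \<in> bad_tuples TYPE('p) b R_Y e0 e1 e2} \<in> sets M \<and>
    measure M {\<omega> \<in> space M. A \<omega> \<in> bad_tuples TYPE('p) b R_Y e0 e1 e2}
      \<le> 4 * exp 1 * \<delta> ^ (tau CARD('p) - CARD('m)) * (3 * \<kappa>) ^ CARD('m)
          * (2 * real CARD('n) ^ 3 * real CARD('m) / (\<sigma> * e0)) ^ tau CARD('p)"
proof
  let ?bad = "bad_tuples TYPE('p) b R_Y e0 e1 e2 :: ((real^'n^'n)^'m) set"
  let ?\<nu> = "lborel_sym_tuples :: ((real^'n^'n)^'m) measure"
  let ?V = "cball Abar \<sigma>"
  have bad: "?bad \<in> sets borel" by (rule bad_tuples_borel)
  have eq: "{\<omega> \<in> space M. A \<omega> \<in> ?bad} = A -` ?bad \<inter> space M" by auto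
  show "{\<omega> \<in> space M. A \<omega> \<in> ?bad} \<in> sets M"
    unfolding eq by (rule measurable_sets[OF assms(12) bad])
  have R_A: "R_A > 0"
    using onorm_pos_le[OF bounded_linear_meas_map[of Abar]] \<open>\<sigma> > 0\<close> by (simp add: R_A_def)
  have \<delta>: "\<delta> \<ge> 0" using R_A \<open>e1 \<ge> 0\<close> \<open>e2 > 0\<close> by (simp add: \<delta>_def)
  have sets: "sets ?\<nu> = sets borel" by (simp add: lborel_sym_tuples_eq)
  \<comment> \<open>The uniform distribution is stated on the ball cut with the symmetric tuples,
    the volume bounds on the full ball; the measure is carried by the subspace, so they
    agree.\<close>
  have Int_sym: "emeasure ?\<nu> (X \<inter> sym_tuples) = emeasure ?\<nu> X" if "X \<in> sets borel" for X
    using emeasure_span_lborel_Int_span[OF that, of sym_tuples_basis]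
    by (simp add: lborel_sym_tuples_eq span_sym_tuples_basis)
  have V: "emeasure ?\<nu> ?V < \<infinity>" "emeasure ?\<nu> ?V > 0"
    using measure_cball_span_lborel(1,2)[OF orthonormal_sym_tuples_basis, of Abar \<sigma>] assms(9,10)
    by (simp_all add: lborel_sym_tuples_eq span_sym_tuples_basis)
  then have V0: "measure ?\<nu> ?V > 0" by (simp add: measure_def enn2real_positive_iff)
  have V': "emeasure ?\<nu> (?V \<inter> sym_tuples) = emeasure ?\<nu> ?V"
    by (rule Int_sym) simp
  have "?bad \<subseteq> sym_tuples" by (auto simp: bad_tuples_def)
  then have Vbad: "?V \<inter> sym_tuples \<inter> ?bad = ?V \<inter> ?bad" by auto
  have prob: "measure M {\<omega> \<in> space M. A \<omega> \<in> ?bad} = measure ?\<nu> (?V \<inter> ?bad) / measure ?\<nu> ?V"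
  proof -
    have "measure M {\<omega> \<in> space M. A \<omega> \<in> ?bad} = measure (distr M borel A) ?bad"
      unfolding eq using measure_distr[OF assms(12) bad] by simp
    also have "\<dots> = measure (uniform_measure ?\<nu> (?V \<inter> sym_tuples)) ?bad"
      unfolding assms(13) ..
    also have "\<dots> = measure ?\<nu> (?V \<inter> sym_tuples \<inter> ?bad) / measure ?\<nu> (?V \<inter> sym_tuples)"
      using V bad by (intro measure_uniform_measure) (auto simp: V' sets)
    also have "measure ?\<nu> (?V \<inter> sym_tuples) = measure ?\<nu> ?V" by (simp add: measure_def V')
    finally show ?thesis by (simp add: Vbad)
  qed
  \<comment> \<open>The net over the multipliers needs a positive mesh, but \<open>\<delta>\<close> may be 0; hence the limit.\<close>
  define g where "g d = 4 * exp 1 * d ^ (tau CARD('p) - CARD('m)) * (3 * \<kappa>) ^ CARD('m)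
          * (2 * real CARD('n) ^ 3 * real CARD('m) / (\<sigma> * e0)) ^ tau CARD('p)" for d :: real
  have "measure ?\<nu> (?V \<inter> ?bad) / measure ?\<nu> ?V \<le> g d"
    if "\<delta> < d" "d < \<sigma> * e0 / (4 * real CARD('n) ^ 3 * real CARD('m))" for d
  proof -
    have "d > 0" using that(1) \<delta> by simp
    from measure_bad_tuples_le[where 'p='p, OF assms(4,6,8,9,10), of e1 d b R_Y,
        folded R_A_def, folded \<delta>_def \<kappa>_def, OF less_imp_le[OF that(1)] this that(2)]
    show ?thesis using V0 by (simp only: pos_divide_le_eq g_def)
  qed
  \<comment> \<open>The strict smallness hypothesis leaves an interval of admissible
    \<open>d\<close> to the right of \<delta>.\<close>
  then have "eventually (\<lambda>d. measure ?\<nu> (?V \<inter> ?bad) / measure ?\<nu> ?V \<le> g d) (at_right \<delta>)"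
    using assms(14) by (auto simp: eventually_at_right)
  moreover have "(g \<longlongrightarrow> g \<delta>) (at_right \<delta>)"
    unfolding g_def by (intro tendsto_intros)
  ultimately have "measure ?\<nu> (?V \<inter> ?bad) / measure ?\<nu> ?V \<le> g \<delta>"
    by (intro tendsto_lowerbound) auto
  then show "measure M {\<omega> \<in> space M. A \<omega> \<in> ?bad} \<le> 4 * exp 1 * \<delta> ^ (tau CARD('p) - CARD('m)) * (3 * \<kappa>) ^ CARD('m)
          * (2 * real CARD('n) ^ 3 * real CARD('m) / (\<sigma> * e0)) ^ tau CARD('p)"
    unfolding prob g_def .
qed

end
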